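(* There are uncountably many pairwise non-congruent tilings of the plane by mixtures of Cairo and Prismatic pentagons, i.e. tilings in which every tile is congruent to the Cairo pentagon or to the Prismatic pentagon and in which both kinds of tile occur.
   Context: A (polygonal) tiling is a decomposition of the plane as a union of polygonal regions (tiles) which meet only along their boundaries. Two tilings are congruent if an isometry of the plane carries one to the other. The Cairo and Prismatic pentagons are the unit-area convex pentagons circumscribed about a circle with two right angles and three angles of $2\pi/3$. In the Cairo pentagon the two right angles are not adjacent (angles in cyclic order $2\pi/3, 2\pi/3, \pi/2, 2\pi/3, \pi/2$): it has one shorter edge of length $a=\frac{2}{3}\sqrt{6-3\sqrt3}$ and four equal longer edges of length $b=\frac{(3+\sqrt3)\sqrt{2-\sqrt3}}{3}$. In the Prismatic pentagon the two right angles are adjacent (angles in cyclic order $2\pi/3,2\pi/3,2\pi/3,\pi/2,\pi/2$): it has two adjacent edges of length $a$, two edges of length $b$, and a base of length $2\sqrt{2-\sqrt3}$ joining the two right angles. *)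

theory Defs
  imports "HOL-Analysis.Analysis"
begin

type_synonym plane = "real ^ 2"

section \<open>Convex polygons in the plane\<close>

(* The unoriented angle at q, with value in [0, pi]; at a vertex of a convex polygon it is the
   interior angle. *)
definition angle_at :: "plane \<Rightarrow> plane \<Rightarrow> plane \<Rightarrow> real" where
  "angle_at p q r = arccos (inner (p - q) (r - q) / (norm (p - q) * norm (r - q)))"

abbreviation next_vertex :: "plane list \<Rightarrow> nat \<Rightarrow> plane" where
  "next_vertex vs i \<equiv> vs ! ((i + 1) mod length vs)"

abbreviation prev_vertex :: "plane list \<Rightarrow> nat \<Rightarrow> plane" where
  "prev_vertex vs i \<equiv> vs ! ((i + length vs - 1) mod length vs)"

abbreviation side :: "plane list \<Rightarrow> nat \<Rightarrow> plane set" where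
  "side vs i \<equiv> closed_segment (vs ! i) (next_vertex vs i)"

(* vs lists the vertices in cyclic order, in one of the two senses of rotation and from an
   arbitrary starting vertex. *)
definition convex_polygon :: "plane list \<Rightarrow> plane set \<Rightarrow> bool" where
  "convex_polygon vs P \<longleftrightarrow>
     length vs \<ge> 3 \<and> distinct vs \<and>
     P = convex hull (set vs) \<and>
     {v. v extreme_point_of P} = set vs \<and>
     (\<forall>i < length vs. side vs i edge_of P)"

definition polygon_angles :: "plane list \<Rightarrow> real list" where
  "polygon_angles vs =
     map (\<lambda>i. angle_at (prev_vertex vs i) (vs ! i) (next_vertex vs i)) [0..<length vs]"

(* Some circle lies in P and touches every side of P; as the disc lies in P, the common point of
   a side and the disc is a point of tangency. *)
definition circumscribed_about_circle :: "plane list \<Rightarrow> plane set \<Rightarrow> bool" where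
  "circumscribed_about_circle vs P \<longleftrightarrow>
     (\<exists>c r. r > 0 \<and> cball c r \<subseteq> P \<and>
        (\<forall>i < length vs. \<exists>t. side vs i \<inter> cball c r = {t}))"

section \<open>The two pentagons\<close>

(* The angles, the inscribed circle and the area determine the pentagon up to an isometry: if r is
   the inradius, the two tangent segments at a right angle have length r and those at an angle
   2*pi/3 have length r / sqrt 3; the area is r^2 * (2 + sqrt 3), so r = sqrt (2 - sqrt 3). Hence
   the sides have length 2*r / sqrt 3 = 2/3 * sqrt (6 - 3 * sqrt 3) between two angles 2*pi/3,
   r * (1 + 1 / sqrt 3) = (3 + sqrt 3) * sqrt (2 - sqrt 3) / 3 between 2*pi/3 and pi/2, and
   2*r between two right angles. So the predicates below say that P is a congruent copy of
   the respective pentagon. *)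
definition cairo_pentagon :: "plane set \<Rightarrow> bool" where
  "cairo_pentagon P \<longleftrightarrow>
     (\<exists>vs. convex_polygon vs P \<and>
        polygon_angles vs = [2*pi/3, 2*pi/3, pi/2, 2*pi/3, pi/2] \<and>
        circumscribed_about_circle vs P \<and>
        measure lebesgue P = 1)"

definition prismatic_pentagon :: "plane set \<Rightarrow> bool" where
  "prismatic_pentagon P \<longleftrightarrow>
     (\<exists>vs. convex_polygon vs P \<and>
        polygon_angles vs = [2*pi/3, 2*pi/3, 2*pi/3, pi/2, pi/2] \<and>
        circumscribed_about_circle vs P \<and>
        measure lebesgue P = 1)"

section \<open>Tilings\<close>

definition polygonal_region :: "plane set \<Rightarrow> bool" where
  "polygonal_region S \<longleftrightarrow>
     connected (interior S) \<and>
     (\<exists>\<F>. finite \<F> \<and> \<F> \<noteq> {} \<and> (\<forall>P \<in> \<F>. polytope P \<and> interior P \<noteq> {}) \<and> S = \<Union>\<F>)"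

definition tiling :: "plane set set \<Rightarrow> bool" where
  "tiling \<T> \<longleftrightarrow>
     (\<forall>T \<in> \<T>. polygonal_region T) \<and>
     \<Union>\<T> = UNIV \<and>
     (\<forall>S \<in> \<T>. \<forall>T \<in> \<T>. S \<noteq> T \<longrightarrow> S \<inter> T \<subseteq> frontier S \<inter> frontier T)"

definition plane_isometry :: "(plane \<Rightarrow> plane) \<Rightarrow> bool" where
  "plane_isometry f \<longleftrightarrow> surj f \<and> (\<forall>x y. dist (f x) (f y) = dist x y)"

definition congruent_tilings :: "plane set set \<Rightarrow> plane set set \<Rightarrow> bool" where
  "congruent_tilings \<S> \<T> \<longleftrightarrow> (\<exists>f. plane_isometry f \<and> (\<lambda>T. f ` T) ` \<S> = \<T>)"

definition cairo_prismatic_tiling :: "plane set set \<Rightarrow> bool" where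
  "cairo_prismatic_tiling \<T> \<longleftrightarrow>
     tiling \<T> \<and>
     (\<forall>T \<in> \<T>. cairo_pentagon T \<or> prismatic_pentagon T) \<and>
     (\<exists>T \<in> \<T>. cairo_pentagon T) \<and>
     (\<exists>T \<in> \<T>. prismatic_pentagon T)"

end

(* Two Prismatic pentagons glued along their bases, or four Cairo pentagons around a common short
   edge, form a centrally symmetric equiangular hexagon. Rows of such hexagons sharing a pair of
   opposite edges are strips between two zigzag lines. Both kinds of hexagon have the same lower
   and upper zigzag, so an arbitrary bi-infinite sequence of Prismatic and Cairo strips can
   be stacked to a tiling. The tiles of all these tilings form a countable set, and an isometry is
   determined by the images of three vertices of a tile; hence each congruence class among the
   uncountably many tilings is countable, and there are uncountably many classes. *)
theory Submission
  imports Defs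
begin

section \<open>Half-planes\<close>

text \<open>Non-congruence cannot be read off the index set: \<open>tiles {0}\<close> and
  \<open>tiles {1}\<close> differ by a translation. Counting congruence classes avoids any
  classification. It only needs the tile positions to come from a countable stock, which holds
  because stacking displaces a strip by \<open>-1\<close> horizontally and by one of the two values
  of \<open>height + 1\<close> vertically. The other obstacle is that the definitions speak of
  hulls, extreme points, arccos, discs and Lebesgue measure, whereas covering and disjointness are
  matters of linear inequalities. Pentagons are therefore intersections of half-planes
  \<open>cross a b x \<ge> 0\<close>, tied once and for all to the other notions; what remains for
  the concrete tiles is arithmetic in \<open>q3\<close>.\<close>

definition cross :: "plane \<Rightarrow> plane \<Rightarrow> plane \<Rightarrow> real" where
  "cross a b x = (b$1 - a$1) * (x$2 - a$2) - (b$2 - a$2) * (x$1 - a$1)"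

definition left_normal :: "plane \<Rightarrow> plane \<Rightarrow> plane" where
  "left_normal a b = vector [a$2 - b$2, b$1 - a$1]"

text \<open>Twice the signed area of the triangle \<open>a b x\<close> is affine in
  \<open>x\<close>, with the left normal of the side as gradient. This makes facts on half-spaces
  and hyperplanes available.\<close>

lemma cross_eq_inner: "cross a b x = left_normal a b \<bullet> x - left_normal a b \<bullet> a"
  by (simp add: cross_def left_normal_def inner_vec_def sum_2 algebra_simps)

lemma cross_rotate: "cross a b c = cross b c a"
  by (simp add: cross_def algebra_simps)

lemma cross_swap: "cross a c b = - cross a b c"
  by (simp add: cross_def algebra_simps)

lemma cross_same [simp]: "cross a a b = 0" "cross a b a = 0" "cross a b b = 0"
  by (simp_all add: cross_def)

lemma left_normal_nonzero: "cross a b x > 0 \<Longrightarrow> left_normal a b \<noteq> 0"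
  by (auto simp: cross_eq_inner)

text \<open>Barycentric coordinates by Cramer's rule: the weight of a corner is the area spanned by
  \<open>x\<close> and the opposite side, divided by the whole area.\<close>

lemma triangle_halfplanes:
  assumes D: "cross a b c > 0"
    and x: "cross a b x \<ge> 0" "cross b c x \<ge> 0" "cross c a x \<ge> 0"
  shows "x \<in> convex hull {a, b, c}"
proof -
  define D where "D = cross a b c"
  have D0: "D > 0" using D by (simp add: D_def)
  have sum: "cross b c x + cross c a x + cross a b x = D"
    by (simp add: D_def cross_def algebra_simps)
  have comb: "cross b c x * a$i + cross c a x * b$i + cross a b x * c$i = D * x$i" if "i = 1 \<or> i = 2" for i
    using that by (auto simp: D_def cross_def algebra_simps)
  have "x = (cross b c x / D) *\<^sub>R a + (cross c a x / D) *\<^sub>R b + (cross a b x / D) *\<^sub>R c"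
    using D0 comb[of 1] comb[of 2] by (auto simp: vec_eq_iff forall_2 field_simps)
  moreover have "cross b c x / D + cross c a x / D + cross a b x / D = 1"
    using sum D0 by (simp add: add_divide_distrib [symmetric])
  ultimately show ?thesis
    using x D0 unfolding convex_hull_3
    by (intro CollectI exI[of _ "cross b c x / D"] exI[of _ "cross c a x / D"] exI[of _ "cross a b x / D"]) auto
qed

lemma convex_cross: "convex {x. cross a b x \<ge> 0}"
  using convex_halfspace_ge[of "left_normal a b \<bullet> a" "left_normal a b"] by (simp add: cross_eq_inner)

lemma interior_cross:
  assumes "cross a b c > 0"
  shows "interior {x. cross a b x \<ge> 0} = {x. cross a b x > 0}"
  using interior_halfspace_ge[OF left_normal_nonzero[OF assms], of "left_normal a b \<bullet> a"]
  by (simp add: cross_eq_inner)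

lemma negligible_cross:
  assumes "cross a b c > 0"
  shows "negligible {x. cross a b x = 0}"
  using negligible_hyperplane[of "left_normal a b" "left_normal a b \<bullet> a"] left_normal_nonzero[OF assms]
  by (simp add: cross_eq_inner)

text \<open>A face of a hull is the hull of some generators, here necessarily those on the
  hyperplane. This reduces edges and extreme points to sign checks at the vertices.\<close>

lemma supporting_face:
  fixes n :: "'a::euclidean_space"
  assumes fin: "finite S" and supp: "\<And>v. v \<in> S \<Longrightarrow> n \<bullet> v \<ge> \<beta>"
  shows "convex hull {v \<in> S. n \<bullet> v = \<beta>} face_of convex hull S"
proof -
  let ?F = "convex hull S \<inter> {x. n \<bullet> x = \<beta>}"
  have "convex hull S \<subseteq> {x. n \<bullet> x \<ge> \<beta>}"
    by (rule hull_minimal) (auto simp: supp convex_halfspace_ge)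
  then have face: "?F face_of convex hull S"
    by (intro face_of_Int_supporting_hyperplane_ge) auto
  then obtain S' where S': "S' \<subseteq> S" "?F = convex hull S'"
    using face_of_convex_hull_subset fin finite_imp_compact by metis
  have "S' \<subseteq> ?F" by (simp add: S'(2) hull_subset)
  then have "S' \<subseteq> {v \<in> S. n \<bullet> v = \<beta>}" using S'(1) by auto
  moreover have "convex hull {v \<in> S. n \<bullet> v = \<beta>} \<subseteq> ?F"
    by (rule hull_minimal) (auto simp: hull_inc convex_Int convex_hyperplane)
  ultimately have "?F = convex hull {v \<in> S. n \<bullet> v = \<beta>}"
    using S'(2) hull_mono by blast
  then show ?thesis using face by simp
qed

section \<open>Convex pentagons\<close>

text \<open>All ten triples must turn left: left turns at consecutive vertices alone would admit a
  pentagram.\<close>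

definition ccw :: "plane \<Rightarrow> plane \<Rightarrow> plane \<Rightarrow> plane \<Rightarrow> plane \<Rightarrow> bool" where
  "ccw p0 p1 p2 p3 p4 \<longleftrightarrow>
     cross p0 p1 p2 > 0 \<and> cross p0 p1 p3 > 0 \<and> cross p0 p1 p4 > 0 \<and> cross p0 p2 p3 > 0 \<and>
     cross p0 p2 p4 > 0 \<and> cross p0 p3 p4 > 0 \<and> cross p1 p2 p3 > 0 \<and> cross p1 p2 p4 > 0 \<and>
     cross p1 p3 p4 > 0 \<and> cross p2 p3 p4 > 0"

lemma ccw_rotate: "ccw p0 p1 p2 p3 p4 \<Longrightarrow> ccw p1 p2 p3 p4 p0"
  unfolding ccw_def by (metis cross_rotate)

lemma ccw_distinct: "ccw p0 p1 p2 p3 p4 \<Longrightarrow> distinct [p0, p1, p2, p3, p4]"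
  unfolding ccw_def by (auto simp: cross_def)

definition pentagon :: "plane \<Rightarrow> plane \<Rightarrow> plane \<Rightarrow> plane \<Rightarrow> plane \<Rightarrow> plane set" where
  "pentagon p0 p1 p2 p3 p4 =
     {x. cross p0 p1 x \<ge> 0 \<and> cross p1 p2 x \<ge> 0 \<and> cross p2 p3 x \<ge> 0 \<and> cross p3 p4 x \<ge> 0 \<and> cross p4 p0 x \<ge> 0}"

lemma pentagon_Int:
  "pentagon p0 p1 p2 p3 p4 = {x. cross p0 p1 x \<ge> 0} \<inter> {x. cross p1 p2 x \<ge> 0} \<inter> {x. cross p2 p3 x \<ge> 0}
     \<inter> {x. cross p3 p4 x \<ge> 0} \<inter> {x. cross p4 p0 x \<ge> 0}"
  by (auto simp: pentagon_def)

context
  fixes p0 p1 p2 p3 p4 :: plane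
  assumes ccw: "ccw p0 p1 p2 p3 p4"
begin

text \<open>The position of \<open>x\<close> relative to the two diagonals from \<open>p0\<close>
  selects a triangle of the fan.\<close>

lemma pentagon_fan:
  assumes "x \<in> pentagon p0 p1 p2 p3 p4"
  shows "x \<in> convex hull {p0, p1, p2} \<union> convex hull {p0, p2, p3} \<union> convex hull {p0, p3, p4}"
proof -
  note x = assms[unfolded pentagon_def, simplified]
  note c = ccw[unfolded ccw_def]
  consider "cross p0 p2 x \<le> 0" | "cross p0 p2 x \<ge> 0" "cross p0 p3 x \<le> 0" | "cross p0 p3 x \<ge> 0"
    by linarith
  then show ?thesis
  proof cases
    case 1
    then have "x \<in> convex hull {p0, p1, p2}"
      using x c by (intro triangle_halfplanes) (auto simp: cross_def algebra_simps)
    then show ?thesis by simp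
  next
    case 2
    then have "x \<in> convex hull {p0, p2, p3}"
      using x c by (intro triangle_halfplanes) (auto simp: cross_def algebra_simps)
    then show ?thesis by simp
  next
    case 3
    then have "x \<in> convex hull {p0, p3, p4}"
      using x c by (intro triangle_halfplanes) (auto simp: cross_def algebra_simps)
    then show ?thesis by simp
  qed
qed

lemma vertices_in_pentagon: "{p0, p1, p2, p3, p4} \<subseteq> pentagon p0 p1 p2 p3 p4"
  using ccw unfolding pentagon_def ccw_def
  by (auto simp: cross_rotate[of p1 _ p0] cross_rotate[of p2 _ p0] cross_rotate[of p3 _ p0]
      cross_rotate[of p4 p0] cross_rotate[of p2 p3 p1] cross_rotate[of p3 p4 p1] cross_rotate[of p3 p4 p2]
      less_imp_le simp flip: cross_rotate)

lemma hull_eq_pentagon: "convex hull {p0, p1, p2, p3, p4} = pentagon p0 p1 p2 p3 p4"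
proof
  show "convex hull {p0, p1, p2, p3, p4} \<subseteq> pentagon p0 p1 p2 p3 p4"
    by (rule hull_minimal[OF vertices_in_pentagon]) (auto simp: pentagon_Int intro!: convex_Int convex_cross)
  have "convex hull {p0, p1, p2} \<union> convex hull {p0, p2, p3} \<union> convex hull {p0, p3, p4}
      \<subseteq> convex hull {p0, p1, p2, p3, p4}"
    by (intro Un_least hull_mono) auto
  then show "pentagon p0 p1 p2 p3 p4 \<subseteq> convex hull {p0, p1, p2, p3, p4}"
    using pentagon_fan by blast
qed

lemma interior_pentagon:
  "interior (pentagon p0 p1 p2 p3 p4) =
     {x. cross p0 p1 x > 0 \<and> cross p1 p2 x > 0 \<and> cross p2 p3 x > 0 \<and> cross p3 p4 x > 0 \<and> cross p4 p0 x > 0}"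
proof -
  have "cross p0 p1 p2 > 0" "cross p1 p2 p3 > 0" "cross p2 p3 p4 > 0" "cross p3 p4 p0 > 0" "cross p4 p0 p1 > 0"
    using ccw unfolding ccw_def by (auto simp: cross_rotate[of p3 p4 p0] cross_rotate[of p4 p0 p1] simp flip: cross_rotate[of p0])
  then show ?thesis
    by (auto simp: pentagon_Int interior_cross)
qed

lemma side_0:
  "closed_segment p0 p1 edge_of pentagon p0 p1 p2 p3 p4" "p0 extreme_point_of pentagon p0 p1 p2 p3 p4"
proof -
  let ?S = "{p0, p1, p2, p3, p4}"
  note c = ccw[unfolded ccw_def]
  note d = ccw_distinct[OF ccw]
  have x4: "cross p4 p0 p1 > 0" "cross p4 p0 p2 > 0" "cross p4 p0 p3 > 0"
    using c by (metis cross_rotate)+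
  have "convex hull {v \<in> ?S. left_normal p0 p1 \<bullet> v = left_normal p0 p1 \<bullet> p0} face_of convex hull ?S"
  proof (rule supporting_face)
    fix v assume "v \<in> ?S"
    then have "cross p0 p1 v \<ge> 0" using c by auto
    then show "left_normal p0 p1 \<bullet> v \<ge> left_normal p0 p1 \<bullet> p0" by (simp add: cross_eq_inner)
  qed simp
  moreover have "{v \<in> ?S. left_normal p0 p1 \<bullet> v = left_normal p0 p1 \<bullet> p0} = {v \<in> ?S. cross p0 p1 v = 0}"
    by (simp add: cross_eq_inner)
  moreover have "{v \<in> ?S. cross p0 p1 v = 0} = {p0, p1}"
    using c by auto
  ultimately have "closed_segment p0 p1 face_of convex hull ?S"
    by (simp add: segment_convex_hull)
  moreover have "aff_dim (closed_segment p0 p1) = 1"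
    using d by (simp add: segment_convex_hull aff_dim_convex_hull aff_dim_2)
  ultimately show "closed_segment p0 p1 edge_of pentagon p0 p1 p2 p3 p4"
    by (simp add: edge_of_def hull_eq_pentagon)
  \<comment> \<open>The inner normals of both sides at \<open>p0\<close> are added: each of the two
    forms is nonnegative at all vertices, and only at \<open>p0\<close> do both vanish.\<close>
  define n where "n = left_normal p0 p1 + left_normal p4 p0"
  have n: "n \<bullet> v - n \<bullet> p0 = cross p0 p1 v + cross p4 p0 v" for v
    using cross_eq_inner[of p4 p0 p0] by (simp add: cross_eq_inner n_def inner_add_left)
  have "convex hull {v \<in> ?S. n \<bullet> v = n \<bullet> p0} face_of convex hull ?S"
  proof (rule supporting_face)
    fix v assume "v \<in> ?S"
    then have "cross p0 p1 v + cross p4 p0 v \<ge> 0" using c x4 by auto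
    then show "n \<bullet> v \<ge> n \<bullet> p0" using n[of v] by simp
  qed simp
  moreover have "{v \<in> ?S. n \<bullet> v = n \<bullet> p0} = {v \<in> ?S. cross p0 p1 v + cross p4 p0 v = 0}"
    using n by (metis (no_types, lifting) eq_iff_diff_eq_0)
  moreover have "{v \<in> ?S. cross p0 p1 v + cross p4 p0 v = 0} = {p0}"
    using c x4 by auto
  ultimately show "p0 extreme_point_of pentagon p0 p1 p2 p3 p4"
    by (simp add: hull_eq_pentagon face_of_singleton)
qed

text \<open>The triangles of the fan meet only on the diagonals from \<open>p0\<close>, which lie on
  null lines, so their areas add up to the shoelace formula.\<close>

lemma measure_pentagon:
  "measure lebesgue (pentagon p0 p1 p2 p3 p4) = (cross p0 p1 p2 + cross p0 p2 p3 + cross p0 p3 p4) / 2"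
proof -
  note c = ccw[unfolded ccw_def]
  have tri: "measure lebesgue (convex hull {a, b, d}) = cross a b d / 2" if "cross a b d > 0" for a b d :: plane
  proof -
    have "cross a b d = - ((d$1 - a$1) * (b$2 - a$2) - (b$1 - a$1) * (d$2 - a$2))"
      by (simp add: cross_def algebra_simps)
    then have "\<bar>(d$1 - a$1) * (b$2 - a$2) - (b$1 - a$1) * (d$2 - a$2)\<bar> = cross a b d"
      using that by linarith
    moreover have "convex hull {a, b, d} \<in> sets lborel"
      by (simp add: borel_compact compact_convex_hull)
    ultimately show ?thesis by (simp add: content_triangle measure_completion)
  qed
  have sub: "convex hull {a, b, d} \<subseteq> {x. cross u v x \<ge> 0}"
    if "cross u v a \<ge> 0" "cross u v b \<ge> 0" "cross u v d \<ge> 0" for a b d u v :: plane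
    using that by (intro hull_minimal convex_cross) auto
  have m: "convex hull {a, b, d} \<in> lmeasurable" for a b d :: plane
    by (intro lmeasurable_compact compact_convex_hull finite_imp_compact) simp
  have neg: "negligible {x. cross p0 p2 x = 0}" "negligible {x. cross p0 p3 x = 0}"
    using c by (auto intro: negligible_cross)
  have rev: "cross b a x = - cross a b x" for a b x
    by (simp add: cross_def algebra_simps)
  have 1: "convex hull {p0, p1, p2} \<subseteq> {x. cross p2 p0 x \<ge> 0}"
    using c by (intro sub) (auto simp: rev[of p2 p0] cross_swap[of p0 p2 p1])
  have 2: "convex hull {p0, p2, p3} \<subseteq> {x. cross p0 p2 x \<ge> 0}"
    using c by (intro sub) auto
  \<comment> \<open>The first diagonal separates the first triangle from the third one as well as
    from the second.\<close>
  have 3: "convex hull {p0, p3, p4} \<subseteq> {x. cross p0 p2 x \<ge> 0}"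
    using c by (intro sub) auto
  have 4: "convex hull {p0, p2, p3} \<subseteq> {x. cross p3 p0 x \<ge> 0}"
    using c by (intro sub) (auto simp: rev[of p3 p0] cross_swap[of p0 p3 p2])
  have 5: "convex hull {p0, p3, p4} \<subseteq> {x. cross p0 p3 x \<ge> 0}"
    using c by (intro sub) auto
  have "measure lebesgue (pentagon p0 p1 p2 p3 p4) = measure lebesgue (convex hull {p0, p1, p2})
      + measure lebesgue (convex hull {p0, p2, p3}) + measure lebesgue (convex hull {p0, p3, p4})"
  proof (rule measure_Un3_negligible[OF m m m])
    show "negligible (convex hull {p0, p1, p2} \<inter> convex hull {p0, p2, p3})"
      using 1 2 by (intro negligible_subset[OF neg(1)]) (force simp: rev[of p2 p0])
    show "negligible (convex hull {p0, p1, p2} \<inter> convex hull {p0, p3, p4})"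
      using 1 3 by (intro negligible_subset[OF neg(1)]) (force simp: rev[of p2 p0])
    show "negligible (convex hull {p0, p2, p3} \<inter> convex hull {p0, p3, p4})"
      using 4 5 by (intro negligible_subset[OF neg(2)]) (force simp: rev[of p3 p0])
    have "convex hull {p0, p1, p2} \<union> convex hull {p0, p2, p3} \<union> convex hull {p0, p3, p4}
      \<subseteq> convex hull {p0, p1, p2, p3, p4}"
      by (intro Un_least hull_mono) auto
    then show "convex hull {p0, p1, p2} \<union> convex hull {p0, p2, p3} \<union> convex hull {p0, p3, p4} = pentagon p0 p1 p2 p3 p4"
      using pentagon_fan hull_eq_pentagon by blast
  qed
  also have "\<dots> = (cross p0 p1 p2 + cross p0 p2 p3 + cross p0 p3 p4) / 2"
    using c by (simp add: tri)
  finally show ?thesis .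
qed

end

lemma less_5_iff: "(\<forall>i < (5::nat). P i) \<longleftrightarrow> P 0 \<and> P 1 \<and> P 2 \<and> P 3 \<and> P 4"
  by (simp add: eval_nat_numeral All_less_Suc conj_ac)

lemma length_5: "length [a, b, c, d, e] = 5"
  by simp

text \<open>\<open>side_0\<close> treats one side and one vertex; the cyclic rotations, which
  preserve \<open>ccw\<close> and the point set, give the others.\<close>

lemma convex_polygon_pentagon:
  assumes "ccw p0 p1 p2 p3 p4"
  shows "convex_polygon [p0, p1, p2, p3, p4] (pentagon p0 p1 p2 p3 p4)"
proof -
  let ?P = "pentagon p0 p1 p2 p3 p4"
  note c0 = assms
  note c1 = ccw_rotate[OF c0]
  note c2 = ccw_rotate[OF c1]
  note c3 = ccw_rotate[OF c2]
  note c4 = ccw_rotate[OF c3]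
  note s = side_0[OF c0] side_0[OF c1] side_0[OF c2] side_0[OF c3] side_0[OF c4]
  have rot: "pentagon p1 p2 p3 p4 p0 = ?P" "pentagon p2 p3 p4 p0 p1 = ?P" "pentagon p3 p4 p0 p1 p2 = ?P"
     "pentagon p4 p0 p1 p2 p3 = ?P"
    by (auto simp: pentagon_def)
  note s = s[unfolded rot]
  have "{v. v extreme_point_of ?P} \<subseteq> {p0, p1, p2, p3, p4}"
    using extreme_point_of_convex_hull hull_eq_pentagon[OF c0] by (metis mem_Collect_eq subsetI)
  then have "{v. v extreme_point_of ?P} = set [p0, p1, p2, p3, p4]"
    using s by auto
  moreover have "\<forall>i < length [p0, p1, p2, p3, p4]. side [p0, p1, p2, p3, p4] i edge_of ?P"
    using s unfolding length_5 less_5_iff by simp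
  ultimately show ?thesis
    using ccw_distinct[OF c0] hull_eq_pentagon[OF c0] by (simp add: convex_polygon_def)
qed

lemma extreme_points_pentagon:
  assumes "ccw p0 p1 p2 p3 p4"
  shows "{v. v extreme_point_of pentagon p0 p1 p2 p3 p4} = {p0, p1, p2, p3, p4}"
  using convex_polygon_pentagon[OF assms] unfolding convex_polygon_def list.set by (elim conjE)

section \<open>Tangential pentagons up to translation and half-turn\<close>

text \<open>A translation for \<open>\<sigma> = 1\<close> and a half-turn for
  \<open>\<sigma> = -1\<close>. Both preserve orientation, so \<open>cross\<close> and
  \<open>ccw\<close> carry over without a change of sign.\<close>

definition place :: "real \<Rightarrow> plane \<Rightarrow> plane \<Rightarrow> plane" where
  "place \<sigma> d x = d + \<sigma> *\<^sub>R x"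

lemma place_diff: "place \<sigma> d x - place \<sigma> d y = \<sigma> *\<^sub>R (x - y)"
  by (simp add: place_def algebra_simps)

definition right_angle :: "plane \<Rightarrow> plane \<Rightarrow> plane \<Rightarrow> bool" where
  "right_angle p q r \<longleftrightarrow> (p - q) \<bullet> (r - q) = 0"

text \<open>
  This says that the cosine is $-1/2$, without the square roots in the norms.
\<close>

definition angle_120 :: "plane \<Rightarrow> plane \<Rightarrow> plane \<Rightarrow> bool" where
  "angle_120 p q r \<longleftrightarrow> (p - q) \<bullet> (r - q) < 0 \<and>
     4 * ((p - q) \<bullet> (r - q))\<^sup>2 = ((p - q) \<bullet> (p - q)) * ((r - q) \<bullet> (r - q))"

lemma angle_at_right: "right_angle p q r \<Longrightarrow> angle_at p q r = pi / 2"
  by (simp add: right_angle_def angle_at_def)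

lemma angle_at_120:
  assumes "angle_120 p q r"
  shows "angle_at p q r = 2 * pi / 3"
proof -
  define I where "I = (p - q) \<bullet> (r - q)"
  have I: "I < 0" "(2 * I)\<^sup>2 = ((p - q) \<bullet> (p - q)) * ((r - q) \<bullet> (r - q))"
    using assms by (auto simp: angle_120_def I_def power_mult_distrib)
  have "norm (p - q) * norm (r - q) = sqrt ((2 * I)\<^sup>2)"
    unfolding I(2) by (simp add: norm_eq_sqrt_inner real_sqrt_mult)
  also have "\<dots> = - 2 * I"
    using I(1) by (simp only: real_sqrt_abs)
  finally have "I / (norm (p - q) * norm (r - q)) = cos (2 * pi / 3)"
    using I(1) by (simp add: cos_120)
  then have "angle_at p q r = arccos (cos (2 * pi / 3))"
    by (simp add: angle_at_def I_def)
  then show ?thesis by (simp add: arccos_cos)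
qed

text \<open>Tangency is expressed by the inner normal of the side being parallel to the radius and
  pointing towards the centre. The factor \<open>\<mu>\<close> is the side length divided by
  \<open>\<rho>\<close>, and leaving it as a witness avoids square roots.\<close>

definition tangent_at :: "plane \<Rightarrow> plane \<Rightarrow> plane \<Rightarrow> real \<Rightarrow> plane \<Rightarrow> bool" where
  "tangent_at a b c \<rho> t \<longleftrightarrow> t \<in> closed_segment a b \<and> norm (t - c) = \<rho> \<and>
     (\<exists>\<mu>>0. left_normal a b = - \<mu> *\<^sub>R (t - c))"

lemma cross_segment: "t \<in> closed_segment a b \<Longrightarrow> cross a b t = 0"
proof -
  assume "t \<in> closed_segment a b"
  then obtain u where t: "t = (1 - u) *\<^sub>R a + u *\<^sub>R b" by (auto simp: in_segment)
  show "cross a b t = 0" unfolding t by (simp add: cross_def algebra_simps)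
qed

text \<open>The side line is the polar of \<open>t\<close>: the position of \<open>x\<close>
  relative to it depends only on the inner product with the radius to \<open>t\<close>.\<close>

lemma tangent_cross:
  assumes "tangent_at a b c \<rho> t"
  obtains \<mu> where "\<mu> > 0" "\<And>x. cross a b x = \<mu> * (\<rho>\<^sup>2 - (t - c) \<bullet> (x - c))"
proof -
  obtain \<mu> where \<mu>: "\<mu> > 0" "left_normal a b = - \<mu> *\<^sub>R (t - c)"
    using assms by (auto simp: tangent_at_def)
  have n: "cross a b x - cross a b t = \<mu> * (\<rho>\<^sup>2 - (t - c) \<bullet> (x - c))" for x
  proof -
    have "cross a b x - cross a b t = left_normal a b \<bullet> (x - t)"
      by (simp add: cross_eq_inner inner_diff_right)
    also have "\<dots> = \<mu> * ((t - c) \<bullet> ((t - c) - (x - c)))"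
      by (simp add: \<mu>(2) inner_diff_left inner_diff_right algebra_simps)
    also have "(t - c) \<bullet> ((t - c) - (x - c)) = \<rho>\<^sup>2 - (t - c) \<bullet> (x - c)"
      using assms by (subst inner_diff_right) (simp add: tangent_at_def dot_square_norm)
    finally show ?thesis .
  qed
  have "cross a b t = 0"
    using assms by (simp add: tangent_at_def cross_segment)
  then show thesis using n \<mu>(1) that by simp
qed

text \<open>Cauchy-Schwarz keeps the disc on the inner side. A point of the side in the disc has
  inner product \<open>\<rho>\<^sup>2\<close> with the radius, and expanding its squared distance to
  \<open>t\<close> then gives at most 0.\<close>

lemma tangent_disc:
  assumes "tangent_at a b c \<rho> t"
  shows "cball c \<rho> \<subseteq> {x. cross a b x \<ge> 0}" "closed_segment a b \<inter> cball c \<rho> = {t}"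
proof -
  obtain \<mu> where \<mu>: "\<mu> > 0" "\<And>x. cross a b x = \<mu> * (\<rho>\<^sup>2 - (t - c) \<bullet> (x - c))"
    using tangent_cross[OF assms] by blast
  have t: "t \<in> closed_segment a b" "norm (t - c) = \<rho>"
    using assms by (auto simp: tangent_at_def)
  show "cball c \<rho> \<subseteq> {x. cross a b x \<ge> 0}"
  proof
    fix x assume "x \<in> cball c \<rho>"
    then have "norm (x - c) \<le> \<rho>" by (simp add: dist_norm norm_minus_commute)
    then have "(t - c) \<bullet> (x - c) \<le> \<rho>\<^sup>2"
      using norm_cauchy_schwarz[of "t - c" "x - c"] t mult_left_mono[of "norm (x - c)" \<rho> \<rho>]
      by (simp add: power2_eq_square) (metis norm_ge_zero order_trans)
    then show "x \<in> {x. cross a b x \<ge> 0}" using \<mu> by simp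
  qed
  have "x = t" if "x \<in> closed_segment a b" "x \<in> cball c \<rho>" for x
  proof -
    have "norm (x - c) \<le> \<rho>" using that(2) by (simp add: dist_norm norm_minus_commute)
    then have le: "(x - c) \<bullet> (x - c) \<le> \<rho>\<^sup>2"
      by (simp add: dot_square_norm power_mono)
    have "cross a b x = 0" using that(1) by (rule cross_segment)
    then have eq: "(t - c) \<bullet> (x - c) = \<rho>\<^sup>2" using \<mu> by simp
    have tt: "(t - c) \<bullet> (t - c) = \<rho>\<^sup>2" using t(2) by (simp add: dot_square_norm)
    have "(x - t) \<bullet> (x - t) = ((x - c) - (t - c)) \<bullet> ((x - c) - (t - c))" by simp
    also have "\<dots> = (x - c) \<bullet> (x - c) - 2 * ((t - c) \<bullet> (x - c)) + (t - c) \<bullet> (t - c)"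
      by (simp add: inner_diff_left inner_diff_right inner_commute)
    also have "\<dots> \<le> 0" using le eq tt by simp
    finally show ?thesis by (metis inner_eq_zero_iff inner_ge_zero order_antisym right_minus_eq)
  qed
  moreover have "t \<in> cball c \<rho>" using t(2) by (simp add: dist_norm norm_minus_commute)
  ultimately show "closed_segment a b \<inter> cball c \<rho> = {t}"
    using t(1) by blast
qed

lemma circumscribed_pentagon:
  assumes "\<rho> > 0"
    and "tangent_at p0 p1 c \<rho> t0" "tangent_at p1 p2 c \<rho> t1" "tangent_at p2 p3 c \<rho> t2"
      "tangent_at p3 p4 c \<rho> t3" "tangent_at p4 p0 c \<rho> t4"
  shows "circumscribed_about_circle [p0, p1, p2, p3, p4] (pentagon p0 p1 p2 p3 p4)"
proof -
  note d = assms(2-6)[THEN tangent_disc(1)] and s = assms(2-6)[THEN tangent_disc(2)]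
  have "cball c \<rho> \<subseteq> pentagon p0 p1 p2 p3 p4"
    using d unfolding pentagon_def by blast
  moreover have "\<forall>i < length [p0, p1, p2, p3, p4]. \<exists>t. side [p0, p1, p2, p3, p4] i \<inter> cball c \<rho> = {t}"
    using s unfolding length_5 less_5_iff by simp
  ultimately show ?thesis
    using assms(1) by (auto simp: circumscribed_about_circle_def)
qed

lemma polygon_angles_5:
  "polygon_angles [p0, p1, p2, p3, p4] =
     [angle_at p4 p0 p1, angle_at p0 p1 p2, angle_at p1 p2 p3, angle_at p2 p3 p4, angle_at p3 p4 p0]"
  by (simp add: polygon_angles_def upt_rec)

section \<open>Invariance under translations and half-turns\<close>

context
  fixes \<sigma> :: real and d :: plane
  assumes \<sigma>: "\<sigma> = 1 \<or> \<sigma> = -1"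
begin

lemma place_inner: "(\<sigma> *\<^sub>R u) \<bullet> (\<sigma> *\<^sub>R v) = u \<bullet> v"
  using \<sigma> by auto

lemma cross_place: "cross (place \<sigma> d a) (place \<sigma> d b) (place \<sigma> d x) = cross a b x"
  using \<sigma> by (auto simp: cross_def place_def algebra_simps)

lemma ccw_place:
  "ccw p0 p1 p2 p3 p4 \<Longrightarrow>
     ccw (place \<sigma> d p0) (place \<sigma> d p1) (place \<sigma> d p2) (place \<sigma> d p3) (place \<sigma> d p4)"
  by (simp add: ccw_def cross_place)

lemma right_angle_place: "right_angle p q r \<Longrightarrow> right_angle (place \<sigma> d p) (place \<sigma> d q) (place \<sigma> d r)"
  by (simp only: right_angle_def place_diff place_inner)

lemma angle_120_place: "angle_120 p q r \<Longrightarrow> angle_120 (place \<sigma> d p) (place \<sigma> d q) (place \<sigma> d r)"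
  by (simp only: angle_120_def place_diff place_inner)

lemma place_place: "place \<sigma> d (place \<sigma> (- \<sigma> *\<^sub>R d) x) = x"
  using \<sigma> by (auto simp: place_def)

lemma place_pentagon_mem:
  "place \<sigma> d x \<in> pentagon (place \<sigma> d p0) (place \<sigma> d p1) (place \<sigma> d p2) (place \<sigma> d p3) (place \<sigma> d p4)
     \<longleftrightarrow> x \<in> pentagon p0 p1 p2 p3 p4"
  by (simp add: pentagon_def cross_place)

lemma tangent_at_place:
  assumes "tangent_at a b c \<rho> t"
  shows "tangent_at (place \<sigma> d a) (place \<sigma> d b) (place \<sigma> d c) \<rho> (place \<sigma> d t)"
proof -
  have "t \<in> closed_segment a b" using assms by (simp add: tangent_at_def)
  then obtain u where u: "0 \<le> u" "u \<le> 1" "t = (1 - u) *\<^sub>R a + u *\<^sub>R b"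
    unfolding in_segment by blast
  have "place \<sigma> d t = (1 - u) *\<^sub>R place \<sigma> d a + u *\<^sub>R place \<sigma> d b"
    by (simp add: u(3) place_def algebra_simps)
  then have "place \<sigma> d t \<in> closed_segment (place \<sigma> d a) (place \<sigma> d b)"
    using u(1,2) by (auto simp: in_segment)
  moreover have "norm (place \<sigma> d t - place \<sigma> d c) = \<rho>"
    using assms \<sigma> by (auto simp: place_diff tangent_at_def)
  moreover have "left_normal (place \<sigma> d a) (place \<sigma> d b) = \<sigma> *\<^sub>R left_normal a b"
    by (simp add: left_normal_def place_def vec_eq_iff forall_2 algebra_simps)
  then have "\<exists>\<mu>>0. left_normal (place \<sigma> d a) (place \<sigma> d b) = - \<mu> *\<^sub>R (place \<sigma> d t - place \<sigma> d c)"
  proof -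
    obtain \<mu> where "\<mu> > 0" "left_normal a b = - \<mu> *\<^sub>R (t - c)"
      using assms unfolding tangent_at_def by blast
    then show ?thesis
      using \<open>left_normal (place \<sigma> d a) (place \<sigma> d b) = \<sigma> *\<^sub>R left_normal a b\<close>
      by (intro exI[of _ \<mu>]) (simp add: place_diff)
  qed
  ultimately show ?thesis by (simp add: tangent_at_def)
qed

end

section \<open>Coordinates\<close>

text \<open>
  The unit of length is the inradius, and the second coordinate is moreover multiplied by
  $\sqrt 3$: all sides of the tiles then have rational slopes (0, 1, -1, 3, -3 or infinity), so
  membership in a tile is linear over the rationals in the coordinates and $\sqrt 3$.
\<close>

definition q3 :: real where "q3 = sqrt 3"

lemma q3_sq [simp]: "q3 * q3 = 3" "q3 * (q3 * x) = 3 * x" "q3\<^sup>2 = 3"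
proof -
  show 1: "q3 * q3 = 3" by (simp add: q3_def)
  then show "q3 * (q3 * x) = 3 * x" by (simp flip: mult.assoc)
  show "q3\<^sup>2 = 3" by (simp add: q3_def)
qed

lemma q3_bounds: "17 / 10 < q3" "q3 < 18 / 10"
  unfolding q3_def by (rule real_less_rsqrt real_less_lsqrt; simp add: power2_eq_square)+

lemma q3_pos [simp]: "0 < q3" "q3 \<noteq> 0"
  using q3_bounds by auto

definition inradius :: real where "inradius = sqrt (2 - q3)"

lemma inradius_pos [simp]: "0 < inradius" "inradius \<noteq> 0" and inradius_sq: "inradius * inradius = 2 - q3"
  using q3_bounds by (auto simp: inradius_def)

definition pt :: "real \<Rightarrow> real \<Rightarrow> plane" where
  "pt x e = vector [inradius * x, inradius * e / q3]"

definition cx :: "plane \<Rightarrow> real" where "cx p = p$1 / inradius"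

definition ce :: "plane \<Rightarrow> real" where "ce p = q3 * p$2 / inradius"

lemma pt_nth [simp]: "pt x e $ 1 = inradius * x" "pt x e $ 2 = inradius * e / q3"
  by (simp_all add: pt_def)

lemma pt_coords [simp]: "pt (cx p) (ce p) = p" "cx (pt x e) = x" "ce (pt x e) = e"
  by (simp_all add: cx_def ce_def vec_eq_iff forall_2)

lemma pt_add: "pt x e + pt x' e' = pt (x + x') (e + e')"
  by (simp add: vec_eq_iff forall_2 algebra_simps add_divide_distrib)

lemma pt_diff: "pt x e - pt x' e' = pt (x - x') (e - e')"
  by (simp add: vec_eq_iff forall_2 algebra_simps diff_divide_distrib)

lemma pt_scale: "s *\<^sub>R pt x e = pt (s * x) (s * e)"
  by (simp add: vec_eq_iff forall_2 algebra_simps)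

lemma pt_inject [simp]: "pt x e = pt x' e' \<longleftrightarrow> x = x' \<and> e = e'"
  by (metis pt_coords(2,3))

lemma inner_pt: "pt x e \<bullet> pt x' e' = inradius\<^sup>2 / 3 * (3 * x * x' + e * e')"
  by (simp add: inner_vec_def sum_2 field_simps power2_eq_square)

lemma cross_pt:
  "cross (pt x0 e0) (pt x1 e1) (pt x2 e2) = inradius\<^sup>2 / q3 * ((x1 - x0) * (e2 - e0) - (e1 - e0) * (x2 - x0))"
  by (simp add: cross_def power2_eq_square field_simps)

lemma cross_pt_pos:
  "cross (pt x0 e0) (pt x1 e1) (pt x2 e2) > 0 \<longleftrightarrow> (x1 - x0) * (e2 - e0) - (e1 - e0) * (x2 - x0) > 0"
  "cross (pt x0 e0) (pt x1 e1) (pt x2 e2) \<ge> 0 \<longleftrightarrow> (x1 - x0) * (e2 - e0) - (e1 - e0) * (x2 - x0) \<ge> 0"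
proof -
  have *: "(k * z > 0) = (z > 0)" "(k * z \<ge> 0) = (z \<ge> 0)" if "k > 0" for k z :: real
    using that by (simp_all add: zero_less_mult_iff zero_le_mult_iff)
  have "inradius\<^sup>2 / q3 > 0" by simp
  note * = *[OF this]
  show "cross (pt x0 e0) (pt x1 e1) (pt x2 e2) > 0 \<longleftrightarrow> (x1 - x0) * (e2 - e0) - (e1 - e0) * (x2 - x0) > 0"
    "cross (pt x0 e0) (pt x1 e1) (pt x2 e2) \<ge> 0 \<longleftrightarrow> (x1 - x0) * (e2 - e0) - (e1 - e0) * (x2 - x0) \<ge> 0"
    unfolding cross_pt using * by blast+
qed

lemma right_angle_pt:
  "right_angle (pt x0 e0) (pt x1 e1) (pt x2 e2) \<longleftrightarrow> 3 * (x0 - x1) * (x2 - x1) + (e0 - e1) * (e2 - e1) = 0"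
  unfolding right_angle_def pt_diff inner_pt by simp

lemma angle_120_pt:
  assumes "3 * (x0 - x1) * (x2 - x1) + (e0 - e1) * (e2 - e1) < 0"
    and "4 * (3 * (x0 - x1) * (x2 - x1) + (e0 - e1) * (e2 - e1))\<^sup>2 =
           (3 * (x0 - x1) * (x0 - x1) + (e0 - e1) * (e0 - e1)) *
           (3 * (x2 - x1) * (x2 - x1) + (e2 - e1) * (e2 - e1))"
  shows "angle_120 (pt x0 e0) (pt x1 e1) (pt x2 e2)"
proof -
  have "k * I < 0 \<and> 4 * (k * I)\<^sup>2 = (k * N) * (k * M)"
    if "k > 0" "I < 0" "4 * I\<^sup>2 = N * M" for k I N M :: real
    using that by (auto simp: mult_pos_neg power2_eq_square)
  moreover have "inradius\<^sup>2 / 3 > 0" by simp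
  ultimately show ?thesis
    using assms unfolding angle_120_def pt_diff inner_pt by blast
qed

lemma tangent_at_pt:
  assumes "0 \<le> s" "s \<le> 1" "\<mu> > 0"
    and "t = (1 - s) * x0 + s * x1" "u = (1 - s) * e0 + s * e1"
    and "3 * (t - c)\<^sup>2 + (u - e)\<^sup>2 = 3"
    and "e1 - e0 = q3 * \<mu> * (t - c)" "q3 * (x0 - x1) = \<mu> * (u - e)"
  shows "tangent_at (pt x0 e0) (pt x1 e1) (pt c e) inradius (pt t u)"
proof -
  have "pt t u \<in> closed_segment (pt x0 e0) (pt x1 e1)"
    unfolding in_segment using assms(1,2,4,5) by (intro exI[of _ s]) (simp add: pt_scale pt_add)
  moreover have "norm (pt t u - pt c e) = inradius"
  proof -
    have *: "3 * (t - c) * (t - c) + (u - e) * (u - e) = 3"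
      using assms(6) by (simp only: power2_eq_square mult.assoc)
    have "(pt t u - pt c e) \<bullet> (pt t u - pt c e) = inradius\<^sup>2"
      unfolding pt_diff inner_pt * by simp
    then show ?thesis by (simp add: norm_eq_sqrt_inner abs_of_pos)
  qed
  moreover have "left_normal (pt x0 e0) (pt x1 e1) = - \<mu> *\<^sub>R (pt t u - pt c e)"
  proof -
    have e: "e0 - e1 = q3 * (- \<mu> * (t - c))" using assms(7) by (simp add: algebra_simps)
    have x: "x1 - x0 = - \<mu> * (u - e) / q3" using assms(8) by (simp add: field_simps)
    have "inradius * (e0 - e1) / q3 = - \<mu> * (inradius * (t - c))" unfolding e by simp
    moreover have "inradius * (x1 - x0) = - \<mu> * (inradius * (u - e) / q3)" unfolding x by simp
    ultimately show ?thesis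
      by (simp add: left_normal_def vec_eq_iff forall_2 algebra_simps diff_divide_distrib)
  qed
  ultimately show ?thesis using assms(3) unfolding tangent_at_def by blast
qed

section \<open>The tiles\<close>

lemma place_image_pentagon:
  assumes \<sigma>: "\<sigma> = 1 \<or> \<sigma> = -1"
  shows "place \<sigma> d ` pentagon p0 p1 p2 p3 p4 =
    pentagon (place \<sigma> d p0) (place \<sigma> d p1) (place \<sigma> d p2) (place \<sigma> d p3) (place \<sigma> d p4)" (is "_ = ?P")
proof
  show "place \<sigma> d ` pentagon p0 p1 p2 p3 p4 \<subseteq> ?P"
    using place_pentagon_mem[OF \<sigma>] by blast
  show "?P \<subseteq> place \<sigma> d ` pentagon p0 p1 p2 p3 p4"
    using place_pentagon_mem[OF \<sigma>] place_place[OF \<sigma>] by (metis image_eqI subsetI)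
qed

lemma cairo_placed:
  assumes \<sigma>: "\<sigma> = 1 \<or> \<sigma> = -1"
    and ccw: "ccw p0 p1 p2 p3 p4"
    and angles: "angle_120 p4 p0 p1" "angle_120 p0 p1 p2" "right_angle p1 p2 p3" "angle_120 p2 p3 p4" "right_angle p3 p4 p0"
    and "\<rho> > 0"
    and tangents: "tangent_at p0 p1 c \<rho> t0" "tangent_at p1 p2 c \<rho> t1" "tangent_at p2 p3 c \<rho> t2"
      "tangent_at p3 p4 c \<rho> t3" "tangent_at p4 p0 c \<rho> t4"
    and area: "cross p0 p1 p2 + cross p0 p2 p3 + cross p0 p3 p4 = 2"
  shows "cairo_pentagon (place \<sigma> d ` pentagon p0 p1 p2 p3 p4)"
  unfolding place_image_pentagon[OF \<sigma>] cairo_pentagon_def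
  using convex_polygon_pentagon[OF ccw_place[OF \<sigma> ccw]]
    circumscribed_pentagon[OF \<open>\<rho> > 0\<close> tangents[THEN tangent_at_place[OF \<sigma>]]]
    measure_pentagon[OF ccw_place[OF \<sigma> ccw]] area
    angles(1,2,4)[THEN angle_120_place[OF \<sigma>], THEN angle_at_120]
    angles(3,5)[THEN right_angle_place[OF \<sigma>], THEN angle_at_right]
  by (intro exI conjI) (auto simp: polygon_angles_5 cross_place[OF \<sigma>])

lemma prismatic_placed:
  assumes \<sigma>: "\<sigma> = 1 \<or> \<sigma> = -1"
    and ccw: "ccw p0 p1 p2 p3 p4"
    and angles: "angle_120 p4 p0 p1" "angle_120 p0 p1 p2" "angle_120 p1 p2 p3" "right_angle p2 p3 p4" "right_angle p3 p4 p0"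
    and "\<rho> > 0"
    and tangents: "tangent_at p0 p1 c \<rho> t0" "tangent_at p1 p2 c \<rho> t1" "tangent_at p2 p3 c \<rho> t2"
      "tangent_at p3 p4 c \<rho> t3" "tangent_at p4 p0 c \<rho> t4"
    and area: "cross p0 p1 p2 + cross p0 p2 p3 + cross p0 p3 p4 = 2"
  shows "prismatic_pentagon (place \<sigma> d ` pentagon p0 p1 p2 p3 p4)"
  unfolding place_image_pentagon[OF \<sigma>] prismatic_pentagon_def
  using convex_polygon_pentagon[OF ccw_place[OF \<sigma> ccw]]
    circumscribed_pentagon[OF \<open>\<rho> > 0\<close> tangents[THEN tangent_at_place[OF \<sigma>]]]
    measure_pentagon[OF ccw_place[OF \<sigma> ccw]] area
    angles(1,2,3)[THEN angle_120_place[OF \<sigma>], THEN angle_at_120]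
    angles(4,5)[THEN right_angle_place[OF \<sigma>], THEN angle_at_right]
  by (intro exI conjI) (auto simp: polygon_angles_5 cross_place[OF \<sigma>])

text \<open>
  An equiangular hexagon with sides $a, 2b, 2b, a, 2b, 2b$ is cut into four Cairo pentagons (two
  shapes and their images under the half-turn about its centre), one with sides
  $a, 2b, a, a, 2b, a$ into two Prismatic pentagons. Both hexagons have a corner at the origin,
  followed by a side $a$ that ends at $(1, -1)$ and a side $2b$.
\<close>

definition prism_shape :: "plane set" where
  "prism_shape = pentagon (pt 0 2) (pt 0 0) (pt 1 (-1)) (pt ((q3 + 3) / 2) ((q3 - 1) / 2))
     (pt ((q3 + 1) / 2) ((q3 + 5) / 2))"

definition cairo_shape_1 :: "plane set" where
  "cairo_shape_1 = pentagon (pt 0 0) (pt 1 (-1)) (pt ((q3 + 3) / 2) ((q3 - 1) / 2))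
     (pt (q3 / 3 + 1) (q3 + 1)) (pt 0 (q3 + 1))"

definition cairo_shape_2 :: "plane set" where
  "cairo_shape_2 = pentagon (pt (q3 / 3 + 1) (q3 + 1)) (pt (2 * q3 / 3 + 1) (2 * q3 + 1))
     (pt ((q3 + 1) / 2) ((5 * q3 + 5) / 2)) (pt 0 (2 * q3 + 2)) (pt 0 (q3 + 1))"

lemma prism_ccw:
  "ccw (pt 0 2) (pt 0 0) (pt 1 (-1)) (pt ((q3 + 3) / 2) ((q3 - 1) / 2)) (pt ((q3 + 1) / 2) ((q3 + 5) / 2))"
  unfolding ccw_def cross_pt_pos using q3_bounds by (simp add: field_simps)

lemma cairo_1_ccw:
  "ccw (pt 0 0) (pt 1 (-1)) (pt ((q3 + 3) / 2) ((q3 - 1) / 2)) (pt (q3 / 3 + 1) (q3 + 1)) (pt 0 (q3 + 1))"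
  unfolding ccw_def cross_pt_pos using q3_bounds by (simp add: field_simps)

lemma cairo_2_ccw:
  "ccw (pt (q3 / 3 + 1) (q3 + 1)) (pt (2 * q3 / 3 + 1) (2 * q3 + 1))
     (pt ((q3 + 1) / 2) ((5 * q3 + 5) / 2)) (pt 0 (2 * q3 + 2)) (pt 0 (q3 + 1))"
  unfolding ccw_def cross_pt_pos using q3_bounds by (simp add: field_simps)

text \<open>The witnesses are metric: \<open>\<mu>\<close> is the side length in units of the
  inradius, namely \<open>2*q3/3\<close>, \<open>1+q3/3\<close> or \<open>2\<close>. The tangent
  lengths are 1 at a right angle and \<open>1/q3\<close> at the other angles, and \<open>s\<close>
  is the share of the first one in its side.\<close>

lemma prismatic_tile:
  assumes "\<sigma> = 1 \<or> \<sigma> = -1"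
  shows "prismatic_pentagon (place \<sigma> d ` prism_shape)"
  unfolding prism_shape_def
proof (rule prismatic_placed[OF assms prism_ccw _ _ _ _ _ inradius_pos(1), where c = "pt 1 1"])
  show "tangent_at (pt 0 2) (pt 0 0) (pt 1 1) inradius (pt 0 1)"
    by (rule tangent_at_pt[where s = "1/2" and \<mu> = "2*q3/3"]) (simp_all)
  show "tangent_at (pt 0 0) (pt 1 (-1)) (pt 1 1) inradius (pt (1/2) (-1/2))"
    by (rule tangent_at_pt[where s = "1/2" and \<mu> = "2*q3/3"]) (simp_all add: power2_eq_square)
  show "tangent_at (pt 1 (-1)) (pt ((q3 + 3) / 2) ((q3 - 1) / 2)) (pt 1 1) inradius (pt (3/2) (-1/2))"
    by (rule tangent_at_pt[where s = "(q3-1)/2" and \<mu> = "1+q3/3"]) (use q3_bounds in \<open>simp_all add: power2_eq_square field_simps\<close>)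
  show "tangent_at (pt ((q3 + 3) / 2) ((q3 - 1) / 2)) (pt ((q3 + 1) / 2) ((q3 + 5) / 2)) (pt 1 1) inradius (pt (1+q3/2) (1+q3/2))"
    by (rule tangent_at_pt[where s = "1/2" and \<mu> = 2]) (use q3_bounds in \<open>simp_all add: power2_eq_square field_simps\<close>)
  show "tangent_at (pt ((q3 + 1) / 2) ((q3 + 5) / 2)) (pt 0 2) (pt 1 1) inradius (pt (1/2) (5/2))"
    by (rule tangent_at_pt[where s = "(3-q3)/2" and \<mu> = "1+q3/3"]) (use q3_bounds in \<open>simp_all add: power2_eq_square field_simps\<close>)
qed (use q3_bounds in \<open>auto intro!: angle_120_pt simp: right_angle_pt cross_pt power2_eq_square field_simps inradius_sq\<close>)

text \<open>Four side lines, and with them the incentre \<open>pt 1 1\<close>, are those of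
  \<open>prism_shape\<close>; only the fifth side differs. The vertex list starts with the short
  side, whose ends are the adjacent angles of 120 degrees, to match the required order of
  angles.\<close>

lemma cairo_tile_1:
  assumes "\<sigma> = 1 \<or> \<sigma> = -1"
  shows "cairo_pentagon (place \<sigma> d ` cairo_shape_1)"
  unfolding cairo_shape_1_def
proof (rule cairo_placed[OF assms cairo_1_ccw _ _ _ _ _ inradius_pos(1), where c = "pt 1 1"])
  show "tangent_at (pt 0 0) (pt 1 (-1)) (pt 1 1) inradius (pt (1/2) (-1/2))"
    by (rule tangent_at_pt[where s = "1/2" and \<mu> = "2*q3/3"]) (simp_all add: power2_eq_square)
  show "tangent_at (pt 1 (-1)) (pt ((q3 + 3) / 2) ((q3 - 1) / 2)) (pt 1 1) inradius (pt (3/2) (-1/2))"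
    by (rule tangent_at_pt[where s = "(q3-1)/2" and \<mu> = "1+q3/3"]) (use q3_bounds in \<open>simp_all add: power2_eq_square field_simps\<close>)
  show "tangent_at (pt ((q3 + 3) / 2) ((q3 - 1) / 2)) (pt (q3 / 3 + 1) (q3 + 1)) (pt 1 1) inradius (pt (1+q3/2) (1+q3/2))"
    by (rule tangent_at_pt[where s = "(3-q3)/2" and \<mu> = "1+q3/3"]) (use q3_bounds in \<open>simp_all add: power2_eq_square field_simps\<close>)
  show "tangent_at (pt (q3 / 3 + 1) (q3 + 1)) (pt 0 (q3 + 1)) (pt 1 1) inradius (pt 1 (q3 + 1))"
    by (rule tangent_at_pt[where s = "(q3-1)/2" and \<mu> = "1+q3/3"]) (use q3_bounds in \<open>simp_all add: power2_eq_square field_simps\<close>)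
  show "tangent_at (pt 0 (q3 + 1)) (pt 0 0) (pt 1 1) inradius (pt 0 1)"
    by (rule tangent_at_pt[where s = "(3-q3)/2" and \<mu> = "1+q3/3"]) (use q3_bounds in \<open>simp_all add: power2_eq_square field_simps\<close>)
qed (use q3_bounds in \<open>auto intro!: angle_120_pt simp: right_angle_pt cross_pt power2_eq_square field_simps inradius_sq\<close>)

text \<open>The two Cairo shapes share a side on the line \<open>e = q3 + 1\<close>, and the
  incentre is the reflection of \<open>pt 1 1\<close> in that line.\<close>

lemma cairo_tile_2:
  assumes "\<sigma> = 1 \<or> \<sigma> = -1"
  shows "cairo_pentagon (place \<sigma> d ` cairo_shape_2)"
  unfolding cairo_shape_2_def
proof (rule cairo_placed[OF assms cairo_2_ccw _ _ _ _ _ inradius_pos(1), where c = "pt 1 (2*q3+1)"])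
  show "tangent_at (pt (q3 / 3 + 1) (q3 + 1)) (pt (2 * q3 / 3 + 1) (2 * q3 + 1)) (pt 1 (2*q3+1)) inradius (pt (1+q3/2) (3*q3/2+1))"
    by (rule tangent_at_pt[where s = "1/2" and \<mu> = "2*q3/3"]) (simp_all add: power2_eq_square field_simps)
  show "tangent_at (pt (2 * q3 / 3 + 1) (2 * q3 + 1)) (pt ((q3 + 1) / 2) ((5 * q3 + 5) / 2)) (pt 1 (2*q3+1)) inradius (pt (1+q3/2) (1+5*q3/2))"
    by (rule tangent_at_pt[where s = "(q3-1)/2" and \<mu> = "1+q3/3"]) (use q3_bounds in \<open>simp_all add: power2_eq_square field_simps\<close>)
  show "tangent_at (pt ((q3 + 1) / 2) ((5 * q3 + 5) / 2)) (pt 0 (2 * q3 + 2)) (pt 1 (2*q3+1)) inradius (pt (1/2) (2*q3+5/2))"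
    by (rule tangent_at_pt[where s = "(3-q3)/2" and \<mu> = "1+q3/3"]) (use q3_bounds in \<open>simp_all add: power2_eq_square field_simps\<close>)
  show "tangent_at (pt 0 (2 * q3 + 2)) (pt 0 (q3 + 1)) (pt 1 (2*q3+1)) inradius (pt 0 (2*q3+1))"
    by (rule tangent_at_pt[where s = "(q3-1)/2" and \<mu> = "1+q3/3"]) (use q3_bounds in \<open>simp_all add: power2_eq_square field_simps\<close>)
  show "tangent_at (pt 0 (q3 + 1)) (pt (q3 / 3 + 1) (q3 + 1)) (pt 1 (2*q3+1)) inradius (pt 1 (q3+1))"
    by (rule tangent_at_pt[where s = "(3-q3)/2" and \<mu> = "1+q3/3"]) (use q3_bounds in \<open>simp_all add: power2_eq_square field_simps\<close>)
qed (use q3_bounds in \<open>auto intro!: angle_120_pt simp: right_angle_pt cross_pt power2_eq_square field_simps inradius_sq\<close>)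

section \<open>Linear inequalities for the tiles\<close>

lemma cross_pt_sign:
  assumes "k > 0" "(x1 - x0) * (e - e0) - (e1 - e0) * (x - x0) = k * l"
  shows "cross (pt x0 e0) (pt x1 e1) (pt x e) \<ge> 0 \<longleftrightarrow> l \<ge> 0"
    and "cross (pt x0 e0) (pt x1 e1) (pt x e) > 0 \<longleftrightarrow> l > 0"
  using assms unfolding cross_pt_pos by (simp_all add: zero_le_mult_iff zero_less_mult_iff)

text \<open>Dividing each \<open>cross\<close> by its positive factor leaves a form with integer
  coefficients at \<open>x\<close> and \<open>e\<close> and with \<open>q3\<close> only in the
  constant term, so linear arithmetic can treat \<open>q3\<close> as a further variable.\<close>

lemma prism_mem:
  "pt x e \<in> prism_shape \<longleftrightarrow> 0 \<le> x \<and> 0 \<le> x + e \<and> 0 \<le> e - x + 2 \<and> 0 \<le> 2 * q3 + 4 - 3 * x - e \<and> 0 \<le> x + 2 - e"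
  "pt x e \<in> interior prism_shape \<longleftrightarrow> 0 < x \<and> 0 < x + e \<and> 0 < e - x + 2 \<and> 0 < 2 * q3 + 4 - 3 * x - e \<and> 0 < x + 2 - e"
proof -
  note b = q3_bounds
  have 1: "(0 - 0) * (e - 2) - (0 - 2) * (x - 0) = 2 * x" by simp
  have 2: "(1 - 0) * (e - 0) - (-1 - 0) * (x - 0) = 1 * (x + e)" by simp
  have 3: "((q3 + 3) / 2 - 1) * (e - (-1)) - ((q3 - 1) / 2 - (-1)) * (x - 1) = (q3 + 1) / 2 * (e - x + 2)"
    by (simp add: field_simps)
  have 4: "((q3 + 1) / 2 - (q3 + 3) / 2) * (e - (q3 - 1) / 2) - ((q3 + 5) / 2 - (q3 - 1) / 2) * (x - (q3 + 3) / 2)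
     = 1 * (2 * q3 + 4 - 3 * x - e)"
    by (simp add: field_simps)
  have 5: "(0 - (q3 + 1) / 2) * (e - (q3 + 5) / 2) - (2 - (q3 + 5) / 2) * (x - (q3 + 1) / 2) = (q3 + 1) / 2 * (x + 2 - e)"
    by (simp add: field_simps)
  have k: "(0::real) < 2" "(0::real) < 1" "0 < (q3 + 1) / 2" using b by auto
  note s = cross_pt_sign[OF k(1) 1] cross_pt_sign[OF k(2) 2] cross_pt_sign[OF k(3) 3] cross_pt_sign[OF k(2) 4] cross_pt_sign[OF k(3) 5]
  show "pt x e \<in> prism_shape \<longleftrightarrow> 0 \<le> x \<and> 0 \<le> x + e \<and> 0 \<le> e - x + 2 \<and> 0 \<le> 2 * q3 + 4 - 3 * x - e \<and> 0 \<le> x + 2 - e"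
    unfolding prism_shape_def pentagon_def mem_Collect_eq s ..
  show "pt x e \<in> interior prism_shape \<longleftrightarrow> 0 < x \<and> 0 < x + e \<and> 0 < e - x + 2 \<and> 0 < 2 * q3 + 4 - 3 * x - e \<and> 0 < x + 2 - e"
    unfolding prism_shape_def interior_pentagon[OF prism_ccw] mem_Collect_eq s ..
qed

lemma cairo_1_mem:
  "pt x e \<in> cairo_shape_1 \<longleftrightarrow> 0 \<le> x + e \<and> 0 \<le> e - x + 2 \<and> 0 \<le> 2 * q3 + 4 - 3 * x - e \<and> 0 \<le> q3 + 1 - e \<and> 0 \<le> x"
  "pt x e \<in> interior cairo_shape_1 \<longleftrightarrow> 0 < x + e \<and> 0 < e - x + 2 \<and> 0 < 2 * q3 + 4 - 3 * x - e \<and> 0 < q3 + 1 - e \<and> 0 < x"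
proof -
  note b = q3_bounds
  have 1: "(1 - 0) * (e - 0) - (-1 - 0) * (x - 0) = 1 * (x + e)" by simp
  have 2: "((q3 + 3) / 2 - 1) * (e - (-1)) - ((q3 - 1) / 2 - (-1)) * (x - 1) = (q3 + 1) / 2 * (e - x + 2)"
    by (simp add: field_simps)
  have 3: "((q3 / 3 + 1) - (q3 + 3) / 2) * (e - (q3 - 1) / 2) - ((q3 + 1) - (q3 - 1) / 2) * (x - (q3 + 3) / 2)
     = (q3 + 3) / 6 * (2 * q3 + 4 - 3 * x - e)"
    by (simp add: field_simps)
  have 4: "(0 - (q3 / 3 + 1)) * (e - (q3 + 1)) - ((q3 + 1) - (q3 + 1)) * (x - (q3 / 3 + 1)) = (q3 / 3 + 1) * (q3 + 1 - e)"
    by (simp add: field_simps)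
  have 5: "(0 - 0) * (e - (q3 + 1)) - (0 - (q3 + 1)) * (x - 0) = (q3 + 1) * x"
    by (simp add: field_simps)
  have k: "(0::real) < 1" "0 < (q3 + 1) / 2" "0 < (q3 + 3) / 6" "0 < q3 / 3 + 1" "0 < q3 + 1" using b by auto
  note s = cross_pt_sign[OF k(1) 1] cross_pt_sign[OF k(2) 2] cross_pt_sign[OF k(3) 3] cross_pt_sign[OF k(4) 4] cross_pt_sign[OF k(5) 5]
  show "pt x e \<in> cairo_shape_1 \<longleftrightarrow> 0 \<le> x + e \<and> 0 \<le> e - x + 2 \<and> 0 \<le> 2 * q3 + 4 - 3 * x - e \<and> 0 \<le> q3 + 1 - e \<and> 0 \<le> x"
    unfolding cairo_shape_1_def pentagon_def mem_Collect_eq s ..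
  show "pt x e \<in> interior cairo_shape_1 \<longleftrightarrow> 0 < x + e \<and> 0 < e - x + 2 \<and> 0 < 2 * q3 + 4 - 3 * x - e \<and> 0 < q3 + 1 - e \<and> 0 < x"
    unfolding cairo_shape_1_def interior_pentagon[OF cairo_1_ccw] mem_Collect_eq s ..
qed

lemma cairo_2_mem:
  "pt x e \<in> cairo_shape_2 \<longleftrightarrow> 0 \<le> e - 3 * x + 2 \<and> 0 \<le> 4 * q3 + 4 - 3 * x - e \<and> 0 \<le> x + 2 * q3 + 2 - e \<and> 0 \<le> x \<and> 0 \<le> e - q3 - 1"
  "pt x e \<in> interior cairo_shape_2 \<longleftrightarrow> 0 < e - 3 * x + 2 \<and> 0 < 4 * q3 + 4 - 3 * x - e \<and> 0 < x + 2 * q3 + 2 - e \<and> 0 < x \<and> 0 < e - q3 - 1"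
proof -
  note b = q3_bounds
  have 1: "((2 * q3 / 3 + 1) - (q3 / 3 + 1)) * (e - (q3 + 1)) - ((2 * q3 + 1) - (q3 + 1)) * (x - (q3 / 3 + 1)) = q3 / 3 * (e - 3 * x + 2)"
    by (simp add: field_simps)
  have 2: "((q3 + 1) / 2 - (2 * q3 / 3 + 1)) * (e - (2 * q3 + 1)) - ((5 * q3 + 5) / 2 - (2 * q3 + 1)) * (x - (2 * q3 / 3 + 1))
     = (q3 + 3) / 6 * (4 * q3 + 4 - 3 * x - e)"
    by (simp add: field_simps)
  have 3: "(0 - (q3 + 1) / 2) * (e - (5 * q3 + 5) / 2) - ((2 * q3 + 2) - (5 * q3 + 5) / 2) * (x - (q3 + 1) / 2)
     = (q3 + 1) / 2 * (x + 2 * q3 + 2 - e)"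
    by (simp add: field_simps)
  have 4: "(0 - 0) * (e - (2 * q3 + 2)) - ((q3 + 1) - (2 * q3 + 2)) * (x - 0) = (q3 + 1) * x"
    by (simp add: field_simps)
  have 5: "((q3 / 3 + 1) - 0) * (e - (q3 + 1)) - ((q3 + 1) - (q3 + 1)) * (x - 0) = (q3 / 3 + 1) * (e - q3 - 1)"
    by (simp add: field_simps)
  have k: "0 < q3 / 3" "0 < (q3 + 3) / 6" "0 < (q3 + 1) / 2" "0 < q3 + 1" "0 < q3 / 3 + 1" using b by auto
  note s = cross_pt_sign[OF k(1) 1] cross_pt_sign[OF k(2) 2] cross_pt_sign[OF k(3) 3] cross_pt_sign[OF k(4) 4] cross_pt_sign[OF k(5) 5]
  show "pt x e \<in> cairo_shape_2 \<longleftrightarrow> 0 \<le> e - 3 * x + 2 \<and> 0 \<le> 4 * q3 + 4 - 3 * x - e \<and> 0 \<le> x + 2 * q3 + 2 - e \<and> 0 \<le> x \<and> 0 \<le> e - q3 - 1"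
    unfolding cairo_shape_2_def pentagon_def mem_Collect_eq s ..
  show "pt x e \<in> interior cairo_shape_2 \<longleftrightarrow> 0 < e - 3 * x + 2 \<and> 0 < 4 * q3 + 4 - 3 * x - e \<and> 0 < x + 2 * q3 + 2 - e \<and> 0 < x \<and> 0 < e - q3 - 1"
    unfolding cairo_shape_2_def interior_pentagon[OF cairo_2_ccw] mem_Collect_eq s ..
qed

lemma interior_place:
  assumes "\<sigma> = 1 \<or> \<sigma> = -1"
  shows "interior (place \<sigma> d ` S) = place \<sigma> d ` interior S"
proof -
  have "place \<sigma> d ` S = (+) d ` ((*\<^sub>R) \<sigma> ` S)" for S
    by (auto simp: place_def)
  moreover have "linear ((*\<^sub>R) \<sigma> :: plane \<Rightarrow> plane)" "inj ((*\<^sub>R) \<sigma> :: plane \<Rightarrow> plane)"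
    using assms by (auto simp: inj_on_def)
  ultimately show ?thesis
    by (simp add: interior_translation interior_injective_linear_image)
qed

lemma mem_place:
  assumes "\<sigma> = 1 \<or> \<sigma> = -1"
  shows "pt x e \<in> place \<sigma> (pt u v) ` S \<longleftrightarrow> pt (\<sigma> * (x - u)) (\<sigma> * (e - v)) \<in> S"
proof -
  have p: "place \<sigma> (pt u v) (pt a b) = pt (u + \<sigma> * a) (v + \<sigma> * b)" for a b
    by (simp add: place_def pt_scale pt_add)
  have "place \<sigma> (pt u v) (pt (\<sigma> * (x - u)) (\<sigma> * (e - v))) = pt x e"
    unfolding p using assms by auto
  moreover have "y = pt (\<sigma> * (x - u)) (\<sigma> * (e - v))" if "pt x e = place \<sigma> (pt u v) y" for y
  proof -
    have "pt x e = pt (u + \<sigma> * cx y) (v + \<sigma> * ce y)"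
      using that p[of "cx y" "ce y"] by simp
    then have "cx y = \<sigma> * (x - u)" "ce y = \<sigma> * (e - v)" using assms by auto
    then show ?thesis by (metis pt_coords(1))
  qed
  ultimately show ?thesis by (metis imageE imageI)
qed

section \<open>The hexagons\<close>

text \<open>
  The length of the vertical sides, the only difference between the two hexagons.
\<close>

definition height :: "bool \<Rightarrow> real" where
  "height c = (if c then 2 * q3 + 2 else 2)"

text \<open>The vector of the half-turn is the corner opposite to \<open>(u, v)\<close>, that is
  \<open>(u + q3 + 2, v + q3 + height c)\<close>.\<close>

definition hexagon :: "bool \<Rightarrow> real \<Rightarrow> real \<Rightarrow> plane set set" where
  "hexagon c u v =
    (if c then {place 1 (pt u v) ` cairo_shape_1, place 1 (pt u v) ` cairo_shape_2,
       place (-1) (pt (u + q3 + 2) (v + 3 * q3 + 2)) ` cairo_shape_1,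
       place (-1) (pt (u + q3 + 2) (v + 3 * q3 + 2)) ` cairo_shape_2}
     else {place 1 (pt u v) ` prism_shape, place (-1) (pt (u + q3 + 2) (v + q3 + 2)) ` prism_shape})"

lemma hexagon_mem_simps:
  "pt x e \<in> place 1 (pt u v) ` S \<longleftrightarrow> pt (x - u) (e - v) \<in> S"
  "pt x e \<in> place (-1) (pt u v) ` S \<longleftrightarrow> pt (u - x) (v - e) \<in> S"
  "pt x e \<in> interior (place 1 (pt u v) ` S) \<longleftrightarrow> pt (x - u) (e - v) \<in> interior S"
  "pt x e \<in> interior (place (-1) (pt u v) ` S) \<longleftrightarrow> pt (u - x) (v - e) \<in> interior S"
  using mem_place[of 1 x e u v] mem_place[of "-1" x e u v] interior_place[of 1] interior_place[of "-1"]
  by (simp_all)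

lemma hexagon_covers:
  assumes "u \<le> x" "x \<le> u + q3 + 2"
    and "max (- (x - u)) (x - u - 2) \<le> e - v"
    and "e - v \<le> min (height c + x - u) (height c + 2 * q3 + 2 - (x - u))"
  shows "\<exists>T \<in> hexagon c u v. pt x e \<in> T"
proof (cases c)
  case True
  let ?p = "place 1 (pt u v)" and ?n = "place (-1) (pt (u + q3 + 2) (v + 3 * q3 + 2))"
  have h: "0 \<le> x - u" "x - u \<le> q3 + 2" "0 \<le> (x - u) + (e - v)" "(x - u) - 2 \<le> e - v"
    "e - v \<le> 2 * q3 + 2 + (x - u)" "e - v \<le> 4 * q3 + 4 - (x - u)"
    using assms True by (auto simp: height_def)
  \<comment> \<open>The line \<open>e - v = 3 * (x - u) - 2\<close> carries the common short edge
    and passes through the centre; cases 2 and 4 lie on its two sides. Cases 3 and 4 are the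
    half-turn images of cases 1 and 2.\<close>
  consider "3 * (x - u) + (e - v) \<le> 2 * q3 + 4" "e - v \<le> q3 + 1"
    | "3 * (x - u) + (e - v) \<le> 4 * q3 + 4" "q3 + 1 \<le> e - v" "3 * (x - u) - 2 \<le> e - v"
    | "4 * q3 + 4 \<le> 3 * (x - u) + (e - v)" "2 * q3 + 1 \<le> e - v"
    | "2 * q3 + 4 \<le> 3 * (x - u) + (e - v)" "e - v \<le> 2 * q3 + 1" "e - v \<le> 3 * (x - u) - 2"
    by linarith
  then have "pt x e \<in> ?p ` cairo_shape_1 \<or> pt x e \<in> ?p ` cairo_shape_2 \<or>
      pt x e \<in> ?n ` cairo_shape_1 \<or> pt x e \<in> ?n ` cairo_shape_2"
  proof cases
    case 1
    then have "pt x e \<in> ?p ` cairo_shape_1"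
      unfolding hexagon_mem_simps cairo_1_mem using h by (intro conjI; linarith)
    then show ?thesis by simp
  next
    case 2
    then have "pt x e \<in> ?p ` cairo_shape_2"
      unfolding hexagon_mem_simps cairo_2_mem using h by (intro conjI; linarith)
    then show ?thesis by simp
  next
    case 3
    then have "pt x e \<in> ?n ` cairo_shape_1"
      unfolding hexagon_mem_simps cairo_1_mem using h by (simp add: algebra_simps)
    then show ?thesis by simp
  next
    case 4
    then have "pt x e \<in> ?n ` cairo_shape_2"
      unfolding hexagon_mem_simps cairo_2_mem using h by (simp add: algebra_simps)
    then show ?thesis by simp
  qed
  then show ?thesis using True by (auto simp: hexagon_def)
next
  case False
  let ?p = "place 1 (pt u v)" and ?n = "place (-1) (pt (u + q3 + 2) (v + q3 + 2))"
  have h: "0 \<le> x - u" "x - u \<le> q3 + 2" "0 \<le> (x - u) + (e - v)" "(x - u) - 2 \<le> e - v"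
    "e - v \<le> 2 + (x - u)" "e - v \<le> 2 * q3 + 4 - (x - u)"
    using assms False by (auto simp: height_def)
  have "pt x e \<in> ?p ` prism_shape \<or> pt x e \<in> ?n ` prism_shape"
  proof (cases "3 * (x - u) + (e - v) \<le> 2 * q3 + 4")
    case True
    then have "pt x e \<in> ?p ` prism_shape"
      unfolding hexagon_mem_simps prism_mem using h by (simp add: algebra_simps)
    then show ?thesis by simp
  next
    case False
    then have "pt x e \<in> ?n ` prism_shape"
      unfolding hexagon_mem_simps prism_mem using h by (simp add: algebra_simps)
    then show ?thesis by simp
  qed
  then show ?thesis using False by (auto simp: hexagon_def)
qed

lemma hexagon_interior:
  assumes "T \<in> hexagon c u v" "pt x e \<in> interior T"
  shows "u < x \<and> x < u + q3 + 2 \<and> max (- (x - u)) (x - u - 2) < e - v \<and>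
     e - v < min (height c + x - u) (height c + 2 * q3 + 2 - (x - u))"
  using assms q3_bounds
  by (auto simp: hexagon_def height_def hexagon_mem_simps prism_mem cairo_1_mem cairo_2_mem split: if_splits)

text \<open>Any two different tiles of a hexagon lie on opposite sides of a side line of one of
  them, so their strict inequalities contradict each other.\<close>

lemma hexagon_disjoint:
  assumes "S \<in> hexagon c u v" "T \<in> hexagon c u v" "pt x e \<in> interior S" "pt x e \<in> interior T"
  shows "S = T"
  using assms q3_bounds
  by (auto simp: hexagon_def hexagon_mem_simps prism_mem cairo_1_mem cairo_2_mem split: if_splits)

section \<open>The tilings\<close>

definition period :: real where "period = q3 + 2"

text \<open>
  The zigzag below a strip is the graph of this function, whose graph is invariant under the
  translation by \<open>(period, q3)\<close>. The zigzag above the strip is the same one, translated by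
  \<open>(-1, height + 1)\<close>, whatever the height; hence strips of both kinds can be stacked at will.
\<close>

definition chain :: "real \<Rightarrow> real" where
  "chain y = (let j = \<lfloor>y / period\<rfloor>; \<xi> = y - j * period in j * q3 + max (- \<xi>) (\<xi> - 2))"

lemma period_pos [simp]: "0 < period" "period \<noteq> 0"
  using q3_bounds by (auto simp: period_def)

lemma floor_period:
  assumes "of_int j * period \<le> y" "y < of_int j * period + period"
  shows "\<lfloor>y / period\<rfloor> = j"
  using assms by (intro floor_unique) (simp_all add: field_simps)

lemma chain_eq:
  assumes "of_int j * period \<le> y" "y < of_int j * period + period"
  shows "chain y = j * q3 + max (- (y - j * period)) (y - j * period - 2)"
  using floor_period[OF assms] by (simp add: chain_def)

text \<open>Within a cell, the zigzag moved by \<open>(-1, 1)\<close> first rises for a width of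
  \<open>q3 + 1\<close> and then falls: the upper boundary of a hexagon without its height. The
  cases split at the peak, where \<open>y + 1\<close> enters the next cell.\<close>

lemma chain_succ:
  assumes "of_int j * period \<le> y" "y < of_int j * period + period"
  shows "chain (y + 1) + 1 = j * q3 + min (y - j * period) (2 * q3 + 2 - (y - j * period))"
proof (cases "y + 1 < of_int j * period + period")
  case True
  then have "chain (y + 1) = j * q3 + max (- (y + 1 - j * period)) (y + 1 - j * period - 2)"
    using assms by (intro chain_eq) auto
  then show ?thesis using True assms q3_bounds by (auto simp: max_def min_def period_def)
next
  case False
  then have "chain (y + 1) = real_of_int (j + 1) * q3
      + max (- (y + 1 - real_of_int (j + 1) * period)) (y + 1 - real_of_int (j + 1) * period - 2)"
    using assms q3_bounds by (intro chain_eq) (auto simp: period_def algebra_simps)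
  moreover have "real_of_int (j + 1) * period = j * period + period" by (simp add: algebra_simps)
  ultimately show ?thesis using False assms q3_bounds
    by (auto simp: max_def min_def period_def algebra_simps)
qed

lemma period_cell:
  obtains j :: int where "of_int j * period \<le> y" "y < of_int j * period + period"
proof
  show "of_int \<lfloor>y / period\<rfloor> * period \<le> y"
    by (rule floor_divide_lower) simp
  show "y < of_int \<lfloor>y / period\<rfloor> * period + period"
    using floor_divide_upper[of period y] by (simp add: algebra_simps)
qed

text \<open>
  Strip \<open>k\<close> is cut into Cairo pentagons iff \<open>k \<in> A\<close>; the strips with negative index are
  Prismatic, so that all the tilings have a tile in common.
\<close>

definition strip :: "nat set \<Rightarrow> int \<Rightarrow> bool" where
  "strip A k \<longleftrightarrow> 0 \<le> k \<and> nat k \<in> A"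

text \<open>Truncation by \<open>nat\<close> switches off one of the two terms. The 3 is
  \<open>height False + 1\<close>, the rise over a Prismatic strip.\<close>

definition base :: "nat set \<Rightarrow> int \<Rightarrow> real" where
  "base A k = (\<Sum>i<nat k. height (i \<in> A) + 1) - 3 * real (nat (- k))"

lemma base_succ: "base A (k + 1) = base A k + height (strip A k) + 1"
proof (cases "0 \<le> k")
  case True
  then have "nat (k + 1) = Suc (nat k)" by simp
  then show ?thesis using True by (simp add: base_def strip_def)
next
  case False
  then have "nat (- k) = Suc (nat (- (k + 1)))" "nat k = 0" "nat (k + 1) = 0" by simp_all
  then show ?thesis using False by (simp add: base_def strip_def height_def)
qed

definition lower :: "nat set \<Rightarrow> int \<Rightarrow> real \<Rightarrow> real" where
  "lower A k x = base A k + chain (x + k)"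

lemma lower_succ:
  assumes "of_int j * period \<le> x + of_int k" "x + of_int k < of_int j * period + period"
  shows "lower A (k + 1) x = base A k + j * q3 + height (strip A k)
     + min (x + k - j * period) (2 * q3 + 2 - (x + k - j * period))"
proof -
  have "lower A (k + 1) x = base A k + height (strip A k) + 1 + chain (x + k + 1)"
    by (simp add: lower_def base_succ add.assoc)
  then show ?thesis using chain_succ[OF assms] by linarith
qed

lemma height_ge: "height c \<ge> 2"
  using q3_bounds by (simp add: height_def)

text \<open>The gap 2 is attained on the vertical sides of Prismatic hexagons. Being uniform, it
  forces the zigzags to pass every height in both directions.\<close>

lemma lower_step: "lower A k x + 2 \<le> lower A (k + 1) x"
proof -
  obtain j :: int where j: "of_int j * period \<le> x + of_int k" "x + of_int k < of_int j * period + period"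
    by (rule period_cell)
  have "lower A k x = base A k + j * q3 + max (- (x + k - j * period)) (x + k - j * period - 2)"
    by (simp add: lower_def chain_eq[OF j])
  then show ?thesis
    using lower_succ[OF j, of A] height_ge[of "strip A k"] j q3_bounds
    by (auto simp: max_def min_def period_def)
qed

lemma int_step_growth:
  fixes f :: "int \<Rightarrow> real"
  assumes "\<And>k. f k + 2 \<le> f (k + 1)" "k \<le> l"
  shows "f k + 2 * of_int (l - k) \<le> f l"
  using assms(2)
proof (induction l rule: int_ge_induct)
  case (step l)
  then show ?case using assms(1)[of l] by simp
qed simp

lemma int_step_locate:
  fixes f :: "int \<Rightarrow> real"
  assumes step: "\<And>k. f k + 2 \<le> f (k + 1)"
  obtains k where "f k \<le> y" "y < f (k + 1)"
proof -
  obtain n :: int where n: "\<bar>y - f 0\<bar> < of_int n"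
    using ex_less_of_int by blast
  then have n0: "0 \<le> n" by linarith
  have lo: "f (- n) \<le> y"
    using int_step_growth[of f "- n" 0, OF step] n n0 by auto
  have hi: "y < f n"
    using int_step_growth[of f 0 n, OF step] n n0 by auto
  have "\<exists>k. f k \<le> y \<and> y < f (k + 1)"
  proof (rule ccontr)
    assume no: "\<nexists>k. f k \<le> y \<and> y < f (k + 1)"
    have "f l \<le> y" if "- n \<le> l" for l
      using that
    proof (induction l rule: int_ge_induct)
      case base
      then show ?case by (rule lo)
    next
      case (step l)
      then show ?case using no by (meson not_le)
    qed
    then show False using hi n0 by (meson leD neg_le_0_iff_le order_trans)
  qed
  then show thesis using that by blast
qed

definition tiles :: "nat set \<Rightarrow> plane set set" where
  "tiles A = (\<Union>k j. hexagon (strip A k) (of_int j * period - of_int k) (base A k + of_int j * q3))"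

lemma tiles_cover: "\<Union> (tiles A) = UNIV"
proof -
  have "\<exists>T \<in> tiles A. pt x e \<in> T" for x e
  proof -
    obtain k where k: "lower A k x \<le> e" "e < lower A (k + 1) x"
      using int_step_locate[of "\<lambda>k. lower A k x", OF lower_step] by blast
    obtain j :: int where j: "of_int j * period \<le> x + of_int k" "x + of_int k < of_int j * period + period"
      by (rule period_cell)
    have "lower A k x = base A k + j * q3 + max (- (x + k - j * period)) (x + k - j * period - 2)"
      by (simp add: lower_def chain_eq[OF j])
    then have "\<exists>T \<in> hexagon (strip A k) (of_int j * period - of_int k) (base A k + of_int j * q3). pt x e \<in> T"
      using k lower_succ[OF j, of A] j
      by (intro hexagon_covers) (auto simp: period_def max_def min_def split: if_splits)
    then show ?thesis unfolding tiles_def by blast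
  qed
  then show ?thesis by (metis UNIV_eq_I UnionI pt_coords(1))
qed

text \<open>An interior point of a tile determines its hexagon: \<open>j\<close> is a floor, and
  \<open>k\<close> is fixed by two consecutive zigzags enclosing the point strictly.\<close>

lemma tiles_interior:
  assumes "T \<in> hexagon (strip A k) (of_int j * period - of_int k) (base A k + of_int j * q3)" "pt x e \<in> interior T"
  shows "\<lfloor>(x + k) / period\<rfloor> = j" "lower A k x < e" "e < lower A (k + 1) x"
proof -
  note h = hexagon_interior[OF assms]
  then have j: "of_int j * period \<le> x + of_int k" "x + of_int k < of_int j * period + period"
    by (auto simp: period_def)
  then show "\<lfloor>(x + k) / period\<rfloor> = j" by (rule floor_period)
  show "lower A k x < e" using h by (auto simp: lower_def chain_eq[OF j] max_def split: if_splits)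
  show "e < lower A (k + 1) x" using h by (auto simp: lower_succ[OF j] min_def split: if_splits)
qed

lemma tiles_disjoint:
  assumes "S \<in> tiles A" "T \<in> tiles A" "p \<in> interior S" "p \<in> interior T"
  shows "S = T"
proof -
  define x e where "x = cx p" and "e = ce p"
  have p: "p = pt x e" by (simp add: x_def e_def)
  obtain k j where S: "S \<in> hexagon (strip A k) (of_int j * period - of_int k) (base A k + of_int j * q3)"
    using assms(1) by (auto simp: tiles_def)
  obtain k' j' where T: "T \<in> hexagon (strip A k') (of_int j' * period - of_int k') (base A k' + of_int j' * q3)"
    using assms(2) by (auto simp: tiles_def)
  note s = tiles_interior[OF S assms(3)[unfolded p]] and t = tiles_interior[OF T assms(4)[unfolded p]]
  have le: "lower A (k + 1) x \<le> lower A l x" if "k < l" for k l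
    using int_step_growth[of "\<lambda>k. lower A k x" "k + 1" l, OF lower_step] that by auto
  have "k = k'"
    using le[of k k'] le[of k' k] s t by (cases k k' rule: linorder_cases) auto
  moreover have "j = j'" using s(1) t(1) \<open>k = k'\<close> by simp
  ultimately show ?thesis
    using hexagon_disjoint[of S _ _ _ T] S T assms(3,4) p by blast
qed

lemma tiles_congruent:
  assumes "T \<in> hexagon c u v"
  shows "cairo_pentagon T \<or> prismatic_pentagon T"
  using assms cairo_tile_1[of 1] cairo_tile_1[of "-1"] cairo_tile_2[of 1] cairo_tile_2[of "-1"]
    prismatic_tile[of 1] prismatic_tile[of "-1"]
  by (auto simp: hexagon_def split: if_splits)

section \<open>Tiles as polygonal regions with disjoint interiors\<close>

lemma convex_polygon_unit_area:
  assumes "convex_polygon vs P" "measure lebesgue P = 1"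
  shows "polytope P" "interior P \<noteq> {}" "finite {v. v extreme_point_of P}"
proof -
  have P: "P = convex hull (set vs)" and ext: "{v. v extreme_point_of P} = set vs"
    using assms(1) by (auto simp: convex_polygon_def)
  show "polytope P" unfolding polytope_def P by blast
  show "finite {v. v extreme_point_of P}" using ext by simp
  have "\<not> negligible P" using assms(2) negligible_imp_measure0 by force
  then show "interior P \<noteq> {}" using negligible_convex_interior[of P] by (simp add: P)
qed

lemma tile_polytope:
  assumes "cairo_pentagon P \<or> prismatic_pentagon P"
  shows "polytope P" "interior P \<noteq> {}" "finite {v. v extreme_point_of P}"
  using assms convex_polygon_unit_area unfolding cairo_pentagon_def prismatic_pentagon_def by blast+

lemma polytope_polygonal_region:
  assumes "polytope P" "interior P \<noteq> {}"
  shows "polygonal_region P"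
  unfolding polygonal_region_def
  using assms by (intro conjI exI[of _ "{P}"]) (auto intro: convex_connected convex_interior polytope_imp_convex)

text \<open>A convex set with nonempty interior lies in the closure of its interior, and an open set
  disjoint from that interior also misses the closure.\<close>

lemma disjoint_interiors_frontier:
  fixes S T :: "plane set"
  assumes "polytope S" "polytope T" "interior S \<noteq> {}" "interior T \<noteq> {}" "interior S \<inter> interior T = {}"
  shows "S \<inter> T \<subseteq> frontier S \<inter> frontier T"
proof -
  have sub: "P \<subseteq> closure (interior P)" if "polytope P" "interior P \<noteq> {}" for P :: "plane set"
    using that convex_closure_interior[of P] polytope_imp_convex closure_subset by metis
  have "interior S \<inter> T = {}"
    using sub[of T] assms open_Int_closure_eq_empty[of "interior S" "interior T"] by auto
  moreover have "S \<inter> interior T = {}"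
    using sub[of S] assms open_Int_closure_eq_empty[of "interior T" "interior S"] by auto
  ultimately show ?thesis
    using closure_subset[of S] closure_subset[of T] unfolding frontier_def by blast
qed

lemma tile_of_tiles: "T \<in> tiles A \<Longrightarrow> cairo_pentagon T \<or> prismatic_pentagon T"
  unfolding tiles_def using tiles_congruent by blast

lemma tiling_tiles: "tiling (tiles A)"
  unfolding tiling_def
proof (intro conjI ballI impI)
  fix T assume T: "T \<in> tiles A"
  show "polygonal_region T"
    using tile_polytope[OF tile_of_tiles[OF T]] by (intro polytope_polygonal_region)
next
  fix S T assume S: "S \<in> tiles A" and T: "T \<in> tiles A" and "S \<noteq> T"
  then have "interior S \<inter> interior T = {}" using tiles_disjoint by blast
  then show "S \<inter> T \<subseteq> frontier S \<inter> frontier T"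
    using tile_polytope[OF tile_of_tiles[OF S]] tile_polytope[OF tile_of_tiles[OF T]]
    by (intro disjoint_interiors_frontier)
qed (rule tiles_cover)

section \<open>Different index sets give different tilings\<close>

lemma cairo_in_tiles:
  assumes "n \<in> A"
  shows "place 1 (pt (- real n) (base A (int n))) ` cairo_shape_1 \<in> tiles A"
proof -
  have "place 1 (pt (- real n) (base A (int n))) ` cairo_shape_1
      \<in> hexagon (strip A (int n)) (of_int 0 * period - of_int (int n)) (base A (int n) + of_int 0 * q3)"
    using assms by (simp add: hexagon_def strip_def)
  then show ?thesis unfolding tiles_def by blast
qed

lemma prism_in_tiles:
  assumes "\<not> strip A k"
  shows "place 1 (pt (- of_int k) (base A k)) ` prism_shape \<in> tiles A"
proof -
  have "place 1 (pt (- of_int k) (base A k)) ` prism_shape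
      \<in> hexagon (strip A k) (of_int 0 * period - of_int k) (base A k + of_int 0 * q3)"
    using assms by (simp add: hexagon_def)
  then show ?thesis unfolding tiles_def by blast
qed

lemma cairo_prismatic_tiles:
  assumes "A \<noteq> {}"
  shows "cairo_prismatic_tiling (tiles A)"
proof -
  obtain n where "n \<in> A" using assms by blast
  have "\<exists>T \<in> tiles A. cairo_pentagon T"
    using cairo_in_tiles[OF \<open>n \<in> A\<close>] cairo_tile_1[of 1] by blast
  moreover have "\<exists>T \<in> tiles A. prismatic_pentagon T"
    using prism_in_tiles[of A "-1"] prismatic_tile[of 1] by (auto simp: strip_def)
  ultimately show ?thesis
    unfolding cairo_prismatic_tiling_def using tiling_tiles tile_of_tiles by blast
qed

text \<open>\<open>base\<close> at \<open>n\<close> depends only on the strips from 0 to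
  \<open>n - 1\<close>, so at the first disagreement a Cairo and a Prismatic tile stand on the same
  corner and overlap.\<close>

lemma tiles_neq:
  assumes "n \<in> A" "n \<notin> B" and agree: "\<And>i. i < n \<Longrightarrow> i \<in> A \<longleftrightarrow> i \<in> B"
  shows "tiles A \<noteq> tiles B"
proof
  assume eq: "tiles A = tiles B"
  have base: "base A (int n) = base B (int n)"
    using agree by (simp add: base_def)
  define b where "b = base B (int n)"
  let ?C = "place 1 (pt (- real n) b) ` cairo_shape_1" and ?P = "place 1 (pt (- real n) b) ` prism_shape"
  have C: "?C \<in> tiles B" using cairo_in_tiles[OF assms(1)] eq base by (simp add: b_def)
  have P: "?P \<in> tiles B" using prism_in_tiles[of B "int n"] assms(2) by (simp add: strip_def b_def)
  \<comment> \<open>This is the common incentre of both shapes.\<close>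
  have "pt (1 - real n) (b + 1) \<in> interior ?C" "pt (1 - real n) (b + 1) \<in> interior ?P"
    using q3_bounds by (simp_all add: hexagon_mem_simps cairo_1_mem prism_mem)
  then have "?C = ?P" using tiles_disjoint[OF C P] by blast
  \<comment> \<open>A vertex of the Prismatic tile that lies above the line
    \<open>e = q3 + 1\<close> bounding the Cairo tile.\<close>
  moreover have "pt ((q3 + 1) / 2 - real n) (b + (q3 + 5) / 2) \<in> ?P"
    using q3_bounds by (simp add: hexagon_mem_simps prism_mem field_simps)
  moreover have "pt ((q3 + 1) / 2 - real n) (b + (q3 + 5) / 2) \<notin> ?C"
    using q3_bounds by (simp add: hexagon_mem_simps cairo_1_mem field_simps)
  ultimately show False by blast
qed

lemma inj_tiles: "inj tiles"
proof (rule injI, rule ccontr)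
  fix A B assume eq: "tiles A = tiles B" and "A \<noteq> B"
  then have ex: "\<exists>n. (n \<in> A) \<noteq> (n \<in> B)" by blast
  define n where "n = (LEAST n. (n \<in> A) \<noteq> (n \<in> B))"
  have n: "(n \<in> A) \<noteq> (n \<in> B)" unfolding n_def using ex by (rule LeastI_ex)
  have agree: "i \<in> A \<longleftrightarrow> i \<in> B" if "i < n" for i
    using not_less_Least[of i "\<lambda>n. (n \<in> A) \<noteq> (n \<in> B)"] that unfolding n_def by blast
  then show False using tiles_neq[of n A B] tiles_neq[of n B A] n eq by blast
qed

section \<open>Congruence classes\<close>

text \<open>Isometries are given by distances alone; the linear part allows faces to be transported
  and vectors to be expanded in a basis.\<close>

lemma plane_isometry_affine:
  assumes "plane_isometry f"
  obtains L where "orthogonal_transformation L" "\<And>x. f x = f 0 + L x"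
proof
  define L where "L x = f x - f 0" for x
  have "dist (f x - f 0) (f y - f 0) = dist x y" for x y
    using assms by (simp add: plane_isometry_def dist_norm)
  then show "orthogonal_transformation L"
    by (simp add: orthogonal_transformation_isometry L_def)
  show "f x = f 0 + L x" for x by (simp add: L_def)
qed

lemma plane_isometry_extreme_point:
  assumes "plane_isometry f" "x extreme_point_of S"
  shows "f x extreme_point_of f ` S"
proof -
  obtain L where L: "orthogonal_transformation L" "\<And>x. f x = f 0 + L x"
    using plane_isometry_affine[OF assms(1)] by blast
  have "L ` {x} face_of L ` S"
    using assms(2) orthogonal_transformation_linear[OF L(1)] orthogonal_transformation_inj[OF L(1)]
    by (simp only: face_of_linear_image face_of_singleton)
  then have "L x extreme_point_of L ` S" by (simp add: face_of_singleton)
  then have "f 0 + L x extreme_point_of (+) (f 0) ` (L ` S)" by (simp only: extreme_point_of_translation_eq)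
  moreover have "(+) (f 0) ` (L ` S) = f ` S"
    unfolding image_image by (rule image_cong[OF refl]) (rule L(2)[symmetric])
  ultimately show ?thesis by (simp only: L(2)[of x, symmetric])
qed

text \<open>By Cramer's rule \<open>x - a\<close> is a combination of \<open>b - a\<close> and
  \<open>c - a\<close>, on which the two linear parts agree.\<close>

lemma plane_isometry_determined:
  assumes f: "plane_isometry f" and g: "plane_isometry g"
    and nondeg: "cross a b c > 0"
    and eq: "f a = g a" "f b = g b" "f c = g c"
  shows "f = g"
proof
  obtain L where L: "orthogonal_transformation L" "\<And>x. f x = f 0 + L x"
    using plane_isometry_affine[OF f] by blast
  obtain M where M: "orthogonal_transformation M" "\<And>x. g x = g 0 + M x"
    using plane_isometry_affine[OF g] by blast
  note lin = orthogonal_transformation_linear[OF L(1)] orthogonal_transformation_linear[OF M(1)]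
  have diff: "f x - f y = L (x - y)" "g x - g y = M (x - y)" for x y
    using L(2)[of x] L(2)[of y] M(2)[of x] M(2)[of y] lin by (simp_all add: linear_diff)
  fix x
  define D where "D = cross a b c"
  have comb: "D *\<^sub>R (x - a) = cross a x c *\<^sub>R (b - a) + cross a b x *\<^sub>R (c - a)"
    by (simp add: D_def vec_eq_iff forall_2 cross_def algebra_simps)
  have "x - a = (1 / D) *\<^sub>R (D *\<^sub>R (x - a))"
    using nondeg by (simp add: D_def)
  then have x: "x - a = (cross a x c / D) *\<^sub>R (b - a) + (cross a b x / D) *\<^sub>R (c - a)"
    unfolding comb by (simp add: scaleR_add_right)
  have "L (b - a) = M (b - a)" "L (c - a) = M (c - a)"
    using diff[of b a] diff[of c a] eq by simp_all
  then have "L (x - a) = M (x - a)"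
    unfolding x using lin by (simp add: linear_add linear_scale)
  then have "f x - f a = g x - g a" by (simp add: diff)
  then show "f x = g x" using eq(1) by simp
qed

section \<open>Congruence is an equivalence relation\<close>

lemma plane_isometry_id: "plane_isometry (\<lambda>x. x)"
  by (simp add: plane_isometry_def)

lemma plane_isometry_comp: "plane_isometry f \<Longrightarrow> plane_isometry g \<Longrightarrow> plane_isometry (\<lambda>x. g (f x))"
  unfolding plane_isometry_def using comp_surj[of f g] by (simp add: o_def)

lemma plane_isometry_inverse:
  assumes "plane_isometry f"
  obtains g where "plane_isometry g" "\<And>x. g (f x) = x"
proof
  have inj: "inj f"
    using assms by (metis dist_eq_0_iff injI plane_isometry_def)
  have surj: "surj f" using assms by (simp add: plane_isometry_def)
  have "dist (inv f x) (inv f y) = dist x y" for x y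
    using assms surj by (metis plane_isometry_def surj_f_inv_f)
  then show "plane_isometry (inv f)"
    using inj by (simp add: plane_isometry_def inj_imp_surj_inv)
  show "inv f (f x) = x" for x using inj by simp
qed

lemma congruent_tilings_refl: "congruent_tilings \<S> \<S>"
  unfolding congruent_tilings_def using plane_isometry_id by (intro exI[of _ "\<lambda>x. x"]) simp

lemma congruent_tilings_sym: "congruent_tilings \<S> \<T> \<Longrightarrow> congruent_tilings \<T> \<S>"
proof -
  assume "congruent_tilings \<S> \<T>"
  then obtain f where f: "plane_isometry f" "(\<lambda>T. f ` T) ` \<S> = \<T>"
    by (auto simp: congruent_tilings_def)
  obtain g where g: "plane_isometry g" "\<And>x. g (f x) = x"
    using plane_isometry_inverse[OF f(1)] by blast
  have "(\<lambda>T. g ` T) ` \<T> = \<S>"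
    unfolding f(2)[symmetric] by (simp add: image_image g(2))
  then show ?thesis using g(1) by (auto simp: congruent_tilings_def)
qed

lemma congruent_tilings_trans:
  "congruent_tilings \<R> \<S> \<Longrightarrow> congruent_tilings \<S> \<T> \<Longrightarrow> congruent_tilings \<R> \<T>"
proof -
  assume "congruent_tilings \<R> \<S>" "congruent_tilings \<S> \<T>"
  then obtain f g where f: "plane_isometry f" "(\<lambda>T. f ` T) ` \<R> = \<S>"
    and g: "plane_isometry g" "(\<lambda>T. g ` T) ` \<S> = \<T>"
    by (auto simp: congruent_tilings_def)
  have "(\<lambda>T. (\<lambda>x. g (f x)) ` T) ` \<R> = \<T>"
    unfolding g(2)[symmetric] f(2)[symmetric] by (simp add: image_image)
  then show ?thesis using plane_isometry_comp[OF f(1) g(1)] by (auto simp: congruent_tilings_def)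
qed

text \<open>
  A congruence is determined by the images of three vertices of one tile, and these are vertices
  of tiles from a countable stock.
\<close>

lemma countable_congruence_class:
  assumes countable: "countable (\<Union>P\<in>\<U>. {v. v extreme_point_of P})"
    and sub: "\<And>\<T>. \<T> \<in> \<F> \<Longrightarrow> \<T> \<subseteq> \<U>"
    and T: "T \<in> \<S>" "a extreme_point_of T" "b extreme_point_of T" "c extreme_point_of T" "cross a b c > 0"
  shows "countable {\<T> \<in> \<F>. congruent_tilings \<S> \<T>}"
proof -
  let ?V = "\<Union>P\<in>\<U>. {v. v extreme_point_of P}" and ?K = "{\<T> \<in> \<F>. congruent_tilings \<S> \<T>}"
  define F where "F \<T> = (SOME f. plane_isometry f \<and> (\<lambda>T. f ` T) ` \<S> = \<T>)" for \<T>
  have F: "plane_isometry (F \<T>) \<and> (\<lambda>T. F \<T> ` T) ` \<S> = \<T>" if "\<T> \<in> ?K" for \<T>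
  proof -
    have "\<exists>f. plane_isometry f \<and> (\<lambda>T. f ` T) ` \<S> = \<T>"
      using that by (simp add: congruent_tilings_def)
    then show ?thesis unfolding F_def by (rule someI_ex)
  qed
  define h where "h \<T> = (F \<T> a, F \<T> b, F \<T> c)" for \<T>
  have "F \<T> x \<in> ?V" if "\<T> \<in> ?K" "x extreme_point_of T" for \<T> x
  proof -
    have "F \<T> ` T \<in> \<T>" using F[OF that(1)] T(1) by blast
    then have "F \<T> ` T \<in> \<U>" using sub that(1) by blast
    moreover have "F \<T> x extreme_point_of F \<T> ` T"
      using plane_isometry_extreme_point F[OF that(1)] that(2) by blast
    ultimately show ?thesis by blast
  qed
  then have "h ` ?K \<subseteq> ?V \<times> ?V \<times> ?V"
    using T(2-4) unfolding h_def by blast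
  then have "countable (h ` ?K)"
    using countable by (meson countable_SIGMA countable_subset)
  moreover have "inj_on h ?K"
  proof (rule inj_onI)
    fix \<T> \<T>' assume 1: "\<T> \<in> ?K" and 2: "\<T>' \<in> ?K" and eq: "h \<T> = h \<T>'"
    have "F \<T> = F \<T>'"
      using plane_isometry_determined[OF _ _ T(5)] F[OF 1] F[OF 2] eq unfolding h_def by blast
    then show "\<T> = \<T>'" using F[OF 1] F[OF 2] by metis
  qed
  ultimately show ?thesis by (rule countable_image_inj_on)
qed

text \<open>With countably many representatives, \<open>F\<close> would be a countable union of
  countable classes.\<close>

lemma uncountable_representatives:
  assumes unc: "uncountable F"
    and refl: "\<And>x. R x x" and sym: "\<And>x y. R x y \<Longrightarrow> R y x" and trans: "\<And>x y z. R x y \<Longrightarrow> R y z \<Longrightarrow> R x z"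
    and classes: "\<And>x. x \<in> F \<Longrightarrow> countable {y \<in> F. R x y}"
  obtains C where "C \<subseteq> F" "uncountable C" "pairwise (\<lambda>x y. \<not> R x y) C"
proof
  define r where "r x = (SOME y. y \<in> F \<and> R x y)" for x
  have r: "r x \<in> F \<and> R x (r x)" if "x \<in> F" for x
    unfolding r_def using that refl by (intro someI_ex[where P = "\<lambda>y. y \<in> F \<and> R x y"]) blast
  have cong: "r x = r y" if "R x y" for x y
  proof -
    \<comment> \<open>Related elements give the same predicate, hence the same choice by
      \<open>SOME\<close>.\<close>
    have "(\<lambda>z. z \<in> F \<and> R x z) = (\<lambda>z. z \<in> F \<and> R y z)"
      using that sym trans by blast
    then show ?thesis by (simp add: r_def)
  qed
  show sub: "r ` F \<subseteq> F" using r by blast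
  show "uncountable (r ` F)"
  proof
    assume "countable (r ` F)"
    then have "countable (\<Union>x \<in> r ` F. {y \<in> F. R x y})"
      using classes sub by (intro countable_UN) auto
    moreover have "F \<subseteq> (\<Union>x \<in> r ` F. {y \<in> F. R x y})" using r sym by blast
    ultimately show False using unc countable_subset by blast
  qed
  show "pairwise (\<lambda>x y. \<not> R x y) (r ` F)"
    unfolding pairwise_def using r cong trans by (metis (no_types, lifting) imageE)
qed

section \<open>Uncountably many tilings\<close>

text \<open>The generators 3 and \<open>2 * q3 + 3\<close> are the two values of
  \<open>height c + 1\<close>; \<open>m\<close> may be negative because of the strips below strip
  0.\<close>

definition base_range :: "real set" where
  "base_range = (\<Union>(m :: int) (n :: nat). {3 * of_int m + (2 * q3 + 3) * of_nat n})"

lemma base_mem: "base A k \<in> base_range"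
proof -
  have "\<exists>m n. (\<Sum>i<l. height (i \<in> A) + 1) = 3 * of_int m + (2 * q3 + 3) * of_nat n" for l
  proof (induction l)
    case 0
    show ?case by (intro exI[of _ 0]) simp
  next
    case (Suc l)
    then obtain m n where mn: "(\<Sum>i<l. height (i \<in> A) + 1) = 3 * of_int m + (2 * q3 + 3) * of_nat n"
      by blast
    show ?case
    proof (cases "l \<in> A")
      case True
      then show ?thesis
        using mn by (intro exI[of _ m] exI[of _ "Suc n"]) (simp add: height_def algebra_simps)
    next
      case False
      then show ?thesis
        using mn by (intro exI[of _ "m + 1"] exI[of _ n]) (simp add: height_def algebra_simps)
    qed
  qed
  then obtain m n where "(\<Sum>i<nat k. height (i \<in> A) + 1) = 3 * of_int m + (2 * q3 + 3) * of_nat n"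
    by blast
  then have "base A k = 3 * of_int (m - int (nat (- k))) + (2 * q3 + 3) * of_nat n"
    by (simp add: base_def algebra_simps)
  then show ?thesis unfolding base_range_def by blast
qed

text \<open>Letting \<open>c\<close>, \<open>k\<close>, \<open>j\<close> and \<open>b\<close> run
  independently frees the stock from \<open>A\<close>, at the price of overlapping pentagons; only
  its countability matters.\<close>

definition all_tiles :: "plane set set" where
  "all_tiles = (\<Union>c k j. \<Union>b\<in>base_range. hexagon c (of_int j * period - of_int k) (b + of_int j * q3))"

lemma tiles_subset_all: "tiles A \<subseteq> all_tiles"
  unfolding tiles_def all_tiles_def using base_mem[of A] by (intro UN_least) (rule subsetI, blast)

lemma countable_all_vertices: "countable (\<Union>P\<in>all_tiles. {v. v extreme_point_of P})"
proof (rule countable_UN)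
  have "countable (hexagon c u v)" for c u v
    by (simp add: hexagon_def)
  then show "countable all_tiles"
    unfolding all_tiles_def base_range_def by (intro countable_UN) auto
  fix P assume "P \<in> all_tiles"
  then have "cairo_pentagon P \<or> prismatic_pentagon P"
    unfolding all_tiles_def using tiles_congruent by blast
  then show "countable {v. v extreme_point_of P}"
    using tile_polytope(3) by (blast intro: countable_finite)
qed

lemma countable_congruent_tiles:
  "countable {\<T> \<in> range tiles. congruent_tilings (tiles A) \<T>}"
proof -
  \<comment> \<open>The corner of strip \<open>-1\<close>, whose \<open>base\<close> is
    \<open>-3\<close> for every \<open>A\<close>.\<close>
  let ?p = "place 1 (pt 1 (-3))"
  let ?T = "?p ` prism_shape"
  have T: "?T \<in> tiles A"
    using prism_in_tiles[of A "-1"] by (simp add: strip_def base_def)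
  have one: "(1::real) = 1 \<or> (1::real) = -1" by simp
  note c = ccw_place[OF one prism_ccw, of "pt 1 (-3)"]
  have "{?p (pt 0 2), ?p (pt 0 0), ?p (pt 1 (-1))} \<subseteq> {v. v extreme_point_of ?T}"
    unfolding prism_shape_def place_image_pentagon[OF one] extreme_points_pentagon[OF c] by blast
  then have ext: "?p (pt 0 2) extreme_point_of ?T" "?p (pt 0 0) extreme_point_of ?T"
      "?p (pt 1 (-1)) extreme_point_of ?T"
    by blast+
  have pos: "cross (?p (pt 0 2)) (?p (pt 0 0)) (?p (pt 1 (-1))) > 0"
    using c by (simp add: ccw_def)
  have sub: "\<T> \<subseteq> all_tiles" if "\<T> \<in> range tiles" for \<T>
    using that tiles_subset_all by blast
  show ?thesis
    by (rule countable_congruence_class[OF countable_all_vertices sub T ext pos])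
qed

text \<open>The empty set is left out because \<open>tiles {}\<close> has only Prismatic strips.
  Cantor's theorem gives the rest.\<close>

lemma uncountable_tilings: "uncountable (tiles ` (- {{}}))"
proof
  assume "countable (tiles ` (- {{}}))"
  then have "countable (- {{}} :: nat set set)"
    by (rule countable_image_inj_on) (rule inj_on_subset[OF inj_tiles subset_UNIV])
  then have "countable (insert {} (- {{}}) :: nat set set)" by simp
  moreover have "insert {} (- {{}}) = (UNIV :: nat set set)" by blast
  ultimately have "countable (UNIV :: nat set set)" by simp
  then obtain f :: "nat \<Rightarrow> nat set" where "range f = UNIV"
    using uncountable_def[of "UNIV :: nat set set"] by blast
  then show False using Cantors_theorem[of "UNIV :: nat set"] by (metis Pow_UNIV)
qed

theorem mainTheorem3:
  shows "\<exists>\<C> :: (real ^ 2) set set set.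
           uncountable \<C> \<and>
           (\<forall>\<T> \<in> \<C>. cairo_prismatic_tiling \<T>) \<and>
           pairwise (\<lambda>\<S> \<T>. \<not> congruent_tilings \<S> \<T>) \<C>"
proof -
  let ?F = "tiles ` (- {{}})"
  have classes: "countable {\<T> \<in> ?F. congruent_tilings \<S> \<T>}" (is "countable ?K") if S: "\<S> \<in> ?F" for \<S>
  proof -
    obtain A where A: "\<S> = tiles A" using S by blast
    have "?K \<subseteq> {\<T> \<in> range tiles. congruent_tilings (tiles A) \<T>}" by (auto simp: A)
    then show ?thesis using countable_congruent_tiles by (rule countable_subset)
  qed
  obtain \<C> where "\<C> \<subseteq> ?F" "uncountable \<C>" "pairwise (\<lambda>\<S> \<T>. \<not> congruent_tilings \<S> \<T>) \<C>"
    by (rule uncountable_representatives[where R = congruent_tilings, OF uncountable_tilings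
          congruent_tilings_refl congruent_tilings_sym congruent_tilings_trans classes])
  moreover have "cairo_prismatic_tiling \<T>" if "\<T> \<in> ?F" for \<T>
    using that cairo_prismatic_tiles by auto
  ultimately show ?thesis
    by (intro exI[of _ \<C>] conjI ballI) auto
qed

end
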